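(* In a raw type theory, let $\Xi=[\mathsf{M}_1:\mathcal{B}_1,\ldots,\mathsf{M}_n:\mathcal{B}_n]$ be a metavariable context and $I=\langle\mathsf{M}_1\mapsto e_1,\ldots,\mathsf{M}_n\mapsto e_n\rangle$ a derivable instantiation of $\Xi$ over the context $\Theta;\Gamma$. If $\Xi;\Gamma\vdash\mathcal{J}$ is derivable, then so is $\Theta;\Gamma\vdash I_*\mathcal{J}$; similarly for boundaries: if $\Xi;\Gamma\vdash\mathcal{B}$ is derivable then so is $\Theta;\Gamma\vdash I_*\mathcal{B}$.
   Context: Setting: finitary type theories over a signature $\Sigma$, with hypothetical judgements $\Theta;\Gamma\vdash\mathcal{J}$ (metavariable context $\Theta$, variable context $\Gamma$, abstracted judgement $\mathcal{J}$) and boundaries $\Theta;\Gamma\vdash\mathcal{B}$ (judgement with a placeholder $\Box$ in place of the head); $\mathcal{B}[e]$ denotes filling the placeholder with head $e$. An instantiation $I$ of $\Xi$ over $\Theta;\Gamma$ maps each $\mathsf{M}_i$ to an argument $e_i$ of matching arity; its action $I_*$ replaces each occurrence $\mathsf{M}_i(t_1,\ldots,t_k)$ by $e_i$ with its abstracted variables substituted by $I_*t_1,\ldots,I_*t_k$, and acts homomorphically elsewhere. $I_{(k)}$ denotes the restriction of $I$ to $\mathsf{M}_1,\ldots,\mathsf{M}_{k-1}$. $I$ is derivable when $\Theta;\Gamma\vdash (I_{(k)*}\mathcal{B}_k)[e_k]$ is derivable for each $k=1,\ldots,n$. A raw type theory is a family of raw rules with deductive system given by the structural rules, instantiations of specific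 rules, and congruence rules of specific object rules.
   Formalization: It is additionally assumed that I_* leaves Γ unchanged (automatic if Ξ and Θ have disjoint metavariable names); without this the claim fails, e.g. Ξ=[M:□ type], Θ=[M:□ type, N:□ type], Γ=[a:M()], I=⟨M↦N()⟩, J = (a:M()). *)

theory Defs
  imports Main
begin

section \<open>Raw syntax\<close>

datatype sclass = Ty | Tm | EqTy | EqTm

type_synonym arity = "sclass \<times> nat"

text \<open>A symbol arity consists of the syntactic class of the symbol and the arity of each
  argument: class and number of bound variables. The same pairs serve as metavariable arity:
  class and number of term arguments.\<close>

type_synonym 's signature = "'s \<rightharpoonup> sclass \<times> arity list"

definition is_signature :: "'s signature \<Rightarrow> bool" where
  "is_signature \<Sigma> \<longleftrightarrow> (\<forall>S c as. \<Sigma> S = Some (c, as) \<longrightarrow> c \<in> {Ty, Tm})"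

type_synonym fvar = nat
type_synonym mvar = nat

text \<open>Type expressions, term expressions and arguments share one datatype; the predicate
  \<open>valid_arg\<close> below singles out the expressions of each class and arity. Free variables are
  named, bound variables are de Bruijn indices, so that \<open>Abs e\<close> is $\{x\}e$ up to renaming
  of $x$. \<open>Star EqTy\<close> and \<open>Star EqTm\<close> are the dummy arguments that stand for
  (omitted) evidence of equality.\<close>

datatype 's expr =
    FVar fvar
  | BVar nat
  | Sym 's "'s expr list"
  | Meta mvar "'s expr list"
  | Star sclass
  | Abs "'s expr"

text \<open>The head of an equality thesis can only be a dummy, so \<open>EqType A B\<close> and
  \<open>EqTerm s t A\<close> do not store it.\<close>

datatype 'e jthesis = IsType 'e | IsTerm 'e 'e | EqType 'e 'e | EqTerm 'e 'e 'e

datatype 'e bthesis = BdType | BdTerm 'e | BdEqType 'e 'e | BdEqTerm 'e 'e 'e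

text \<open>In \<open>JAbs A J\<close> and \<open>BAbs A B\<close>, index 0 is bound in \<open>J\<close> and \<open>B\<close>, not in \<open>A\<close>.\<close>

datatype 's judgement = JThesis "'s expr jthesis" | JAbs "'s expr" "'s judgement"

datatype 's boundary = BThesis "'s expr bthesis" | BAbs "'s expr" "'s boundary"

type_synonym 's mctx = "(mvar \<times> 's boundary) list"
type_synonym 's vctx = "(fvar \<times> 's expr) list"
type_synonym 's inst_map = "(mvar \<times> 's expr) list"

abbreviation dom_ctx :: "('k \<times> 'v) list \<Rightarrow> 'k set" where
  "dom_ctx \<Gamma> \<equiv> fst ` set \<Gamma>"

primrec fv :: "'s expr \<Rightarrow> fvar set" where
  "fv (FVar a) = {a}"
| "fv (BVar i) = {}"
| "fv (Sym S es) = \<Union> (set (map fv es))"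
| "fv (Meta M ts) = \<Union> (set (map fv ts))"
| "fv (Star c) = {}"
| "fv (Abs e) = fv e"

primrec fv_judgement :: "'s judgement \<Rightarrow> fvar set" where
  "fv_judgement (JThesis j) = \<Union> (fv ` set_jthesis j)"
| "fv_judgement (JAbs A J) = fv A \<union> fv_judgement J"

primrec fv_boundary :: "'s boundary \<Rightarrow> fvar set" where
  "fv_boundary (BThesis b) = \<Union> (fv ` set_bthesis b)"
| "fv_boundary (BAbs A B) = fv A \<union> fv_boundary B"


section \<open>Substitution for bound variables\<close>

primrec lift :: "nat \<Rightarrow> 's expr \<Rightarrow> 's expr" where
  "lift k (FVar a) = FVar a"
| "lift k (BVar i) = BVar (if i < k then i else Suc i)"
| "lift k (Sym S es) = Sym S (map (lift k) es)"
| "lift k (Meta M ts) = Meta M (map (lift k) ts)"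
| "lift k (Star c) = Star c"
| "lift k (Abs e) = Abs (lift (Suc k) e)"

primrec bsubst :: "nat \<Rightarrow> 's expr \<Rightarrow> 's expr \<Rightarrow> 's expr" where
  "bsubst k u (FVar a) = FVar a"
| "bsubst k u (BVar i) = (if i < k then BVar i else if i = k then u else BVar (i - 1))"
| "bsubst k u (Sym S es) = Sym S (map (bsubst k u) es)"
| "bsubst k u (Meta M ts) = Meta M (map (bsubst k u) ts)"
| "bsubst k u (Star c) = Star c"
| "bsubst k u (Abs e) = Abs (bsubst (Suc k) (lift 0 u) e)"

primrec bsubst_judgement :: "nat \<Rightarrow> 's expr \<Rightarrow> 's judgement \<Rightarrow> 's judgement" where
  "bsubst_judgement k u (JThesis j) = JThesis (map_jthesis (bsubst k u) j)"
| "bsubst_judgement k u (JAbs A J) =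
     JAbs (bsubst k u A) (bsubst_judgement (Suc k) (lift 0 u) J)"

primrec bsubst_boundary :: "nat \<Rightarrow> 's expr \<Rightarrow> 's boundary \<Rightarrow> 's boundary" where
  "bsubst_boundary k u (BThesis b) = BThesis (map_bthesis (bsubst k u) b)"
| "bsubst_boundary k u (BAbs A B) =
     BAbs (bsubst k u A) (bsubst_boundary (Suc k) (lift 0 u) B)"

text \<open>\<open>apply_arg\<close> sends $\{x_1\}\cdots\{x_m\}e$ and $t_1,\ldots,t_m$ to
  $e[t_1/x_1,\ldots,t_m/x_m]$. It is only ever used with matching numbers of abstractions and
  arguments; the last equation is a default value.\<close>

fun apply_arg :: "'s expr \<Rightarrow> 's expr list \<Rightarrow> 's expr" where
  "apply_arg e [] = e"
| "apply_arg (Abs e) (t # ts) = apply_arg (bsubst 0 t e) ts"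
| "apply_arg e (t # ts) = e"

text \<open>$e[t_1/x_1,\ldots,t_m/x_m]$ for an expression in the scope of
  $\{x_1\}\cdots\{x_m\}$, so that $x_m$ is index 0 and $x_1$ is index $m-1$.\<close>

definition bsubsts :: "'s expr list \<Rightarrow> 's expr \<Rightarrow> 's expr" where
  "bsubsts ts e = apply_arg ((Abs ^^ length ts) e) ts"


section \<open>Arity and valid raw expressions\<close>

text \<open>\<open>valid_arg \<Sigma> \<Phi> V d (c, n) e\<close>: \<open>e\<close> is an argument of class \<open>c\<close> with \<open>n\<close> abstractions over
  the metavariable arity map \<open>\<Phi>\<close>, with free variables in \<open>V\<close> and \<open>d\<close> bound variables in scope.
  Metavariables of the equality classes do not form expressions.\<close>

inductive valid_arg ::
  "'s signature \<Rightarrow> (mvar \<rightharpoonup> arity) \<Rightarrow> fvar set \<Rightarrow> nat \<Rightarrow> arity \<Rightarrow> 's expr \<Rightarrow> bool"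
  for \<Sigma> :: "'s signature" and \<Phi> :: "mvar \<rightharpoonup> arity" and V :: "fvar set"
where
  valid_FVar: "a \<in> V \<Longrightarrow> valid_arg \<Sigma> \<Phi> V d (Tm, 0) (FVar a)"
| valid_BVar: "i < d \<Longrightarrow> valid_arg \<Sigma> \<Phi> V d (Tm, 0) (BVar i)"
| valid_Sym: "\<Sigma> S = Some (c, as) \<Longrightarrow> list_all2 (valid_arg \<Sigma> \<Phi> V d) as es
    \<Longrightarrow> valid_arg \<Sigma> \<Phi> V d (c, 0) (Sym S es)"
| valid_Meta: "\<Phi> M = Some (c, length ts) \<Longrightarrow> c \<in> {Ty, Tm}
    \<Longrightarrow> (\<forall>t \<in> set ts. valid_arg \<Sigma> \<Phi> V d (Tm, 0) t)
    \<Longrightarrow> valid_arg \<Sigma> \<Phi> V d (c, 0) (Meta M ts)"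
| valid_Star: "c \<in> {EqTy, EqTm} \<Longrightarrow> valid_arg \<Sigma> \<Phi> V d (c, 0) (Star c)"
| valid_Abs: "valid_arg \<Sigma> \<Phi> V (Suc d) (c, n) e \<Longrightarrow> valid_arg \<Sigma> \<Phi> V d (c, Suc n) (Abs e)"

abbreviation valid_ty ::
  "'s signature \<Rightarrow> (mvar \<rightharpoonup> arity) \<Rightarrow> fvar set \<Rightarrow> nat \<Rightarrow> 's expr \<Rightarrow> bool" where
  "valid_ty \<Sigma> \<Phi> V d \<equiv> valid_arg \<Sigma> \<Phi> V d (Ty, 0)"

abbreviation valid_tm ::
  "'s signature \<Rightarrow> (mvar \<rightharpoonup> arity) \<Rightarrow> fvar set \<Rightarrow> nat \<Rightarrow> 's expr \<Rightarrow> bool" where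
  "valid_tm \<Sigma> \<Phi> V d \<equiv> valid_arg \<Sigma> \<Phi> V d (Tm, 0)"

primrec valid_jthesis ::
  "'s signature \<Rightarrow> (mvar \<rightharpoonup> arity) \<Rightarrow> fvar set \<Rightarrow> nat \<Rightarrow> 's expr jthesis \<Rightarrow> bool" where
  "valid_jthesis \<Sigma> \<Phi> V d (IsType A) \<longleftrightarrow> valid_ty \<Sigma> \<Phi> V d A"
| "valid_jthesis \<Sigma> \<Phi> V d (IsTerm t A) \<longleftrightarrow> valid_tm \<Sigma> \<Phi> V d t \<and> valid_ty \<Sigma> \<Phi> V d A"
| "valid_jthesis \<Sigma> \<Phi> V d (EqType A B) \<longleftrightarrow> valid_ty \<Sigma> \<Phi> V d A \<and> valid_ty \<Sigma> \<Phi> V d B"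
| "valid_jthesis \<Sigma> \<Phi> V d (EqTerm s t A) \<longleftrightarrow>
     valid_tm \<Sigma> \<Phi> V d s \<and> valid_tm \<Sigma> \<Phi> V d t \<and> valid_ty \<Sigma> \<Phi> V d A"

primrec valid_bthesis ::
  "'s signature \<Rightarrow> (mvar \<rightharpoonup> arity) \<Rightarrow> fvar set \<Rightarrow> nat \<Rightarrow> 's expr bthesis \<Rightarrow> bool" where
  "valid_bthesis \<Sigma> \<Phi> V d BdType \<longleftrightarrow> True"
| "valid_bthesis \<Sigma> \<Phi> V d (BdTerm A) \<longleftrightarrow> valid_ty \<Sigma> \<Phi> V d A"
| "valid_bthesis \<Sigma> \<Phi> V d (BdEqType A B) \<longleftrightarrow> valid_ty \<Sigma> \<Phi> V d A \<and> valid_ty \<Sigma> \<Phi> V d B"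
| "valid_bthesis \<Sigma> \<Phi> V d (BdEqTerm s t A) \<longleftrightarrow>
     valid_tm \<Sigma> \<Phi> V d s \<and> valid_tm \<Sigma> \<Phi> V d t \<and> valid_ty \<Sigma> \<Phi> V d A"

primrec valid_boundary ::
  "'s signature \<Rightarrow> (mvar \<rightharpoonup> arity) \<Rightarrow> fvar set \<Rightarrow> nat \<Rightarrow> 's boundary \<Rightarrow> bool" where
  "valid_boundary \<Sigma> \<Phi> V d (BThesis b) \<longleftrightarrow> valid_bthesis \<Sigma> \<Phi> V d b"
| "valid_boundary \<Sigma> \<Phi> V d (BAbs A B) \<longleftrightarrow>
     valid_ty \<Sigma> \<Phi> V d A \<and> valid_boundary \<Sigma> \<Phi> V (Suc d) B"

primrec class_bthesis :: "'e bthesis \<Rightarrow> sclass" where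
  "class_bthesis BdType = Ty"
| "class_bthesis (BdTerm A) = Tm"
| "class_bthesis (BdEqType A B) = EqTy"
| "class_bthesis (BdEqTerm s t A) = EqTm"

primrec class_boundary :: "'s boundary \<Rightarrow> sclass" where
  "class_boundary (BThesis b) = class_bthesis b"
| "class_boundary (BAbs A B) = class_boundary B"

primrec abs_depth :: "'s boundary \<Rightarrow> nat" where
  "abs_depth (BThesis b) = 0"
| "abs_depth (BAbs A B) = Suc (abs_depth B)"

definition arity_boundary :: "'s boundary \<Rightarrow> arity" where
  "arity_boundary B = (class_boundary B, abs_depth B)"

definition object_boundary :: "'s boundary \<Rightarrow> bool" where
  "object_boundary B \<longleftrightarrow> class_boundary B \<in> {Ty, Tm}"

definition mv_arity :: "'s mctx \<Rightarrow> (mvar \<rightharpoonup> arity)" where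
  "mv_arity \<Theta> = map_option arity_boundary \<circ> map_of \<Theta>"

text \<open>These notions of context only concern scoping and arity: boundaries in a metavariable
  context are closed and mention earlier metavariables only, and types in a variable context
  mention earlier variables only. No derivability is required.\<close>

definition is_mctx :: "'s signature \<Rightarrow> 's mctx \<Rightarrow> bool" where
  "is_mctx \<Sigma> \<Theta> \<longleftrightarrow> distinct (map fst \<Theta>) \<and>
     (\<forall>i < length \<Theta>. valid_boundary \<Sigma> (mv_arity (take i \<Theta>)) {} 0 (snd (\<Theta> ! i)))"

definition is_vctx :: "'s signature \<Rightarrow> 's mctx \<Rightarrow> 's vctx \<Rightarrow> bool" where
  "is_vctx \<Sigma> \<Theta> \<Gamma> \<longleftrightarrow> distinct (map fst \<Gamma>) \<and>
     (\<forall>i < length \<Gamma>. valid_ty \<Sigma> (mv_arity \<Theta>) (dom_ctx (take i \<Gamma>)) 0 (snd (\<Gamma> ! i)))"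

definition is_ctx :: "'s signature \<Rightarrow> 's mctx \<Rightarrow> 's vctx \<Rightarrow> bool" where
  "is_ctx \<Sigma> \<Theta> \<Gamma> \<longleftrightarrow> is_mctx \<Sigma> \<Theta> \<and> is_vctx \<Sigma> \<Theta> \<Gamma>"


section \<open>Filling a boundary with a head\<close>

primrec fill_thesis :: "'e bthesis \<Rightarrow> 'e \<Rightarrow> 'e jthesis" where
  "fill_thesis BdType e = IsType e"
| "fill_thesis (BdTerm A) e = IsTerm e A"
| "fill_thesis (BdEqType A B) e = EqType A B"
| "fill_thesis (BdEqTerm s t A) e = EqTerm s t A"

text \<open>No meaning is attached to \<open>fill\<close> and \<open>fill_eq\<close> unless the shapes match and,
  for \<open>fill_eq\<close>, the boundary is an object boundary.\<close>

fun fill :: "'s boundary \<Rightarrow> 's expr \<Rightarrow> 's judgement" where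
  "fill (BThesis b) e = JThesis (fill_thesis b e)"
| "fill (BAbs A B) (Abs e) = JAbs A (fill B e)"

fun fill_eq :: "'s boundary \<Rightarrow> 's expr \<Rightarrow> 's expr \<Rightarrow> 's judgement" where
  "fill_eq (BThesis BdType) A1 A2 = JThesis (EqType A1 A2)"
| "fill_eq (BThesis (BdTerm A)) t1 t2 = JThesis (EqTerm t1 t2 A)"
| "fill_eq (BAbs A B) (Abs e1) (Abs e2) = JAbs A (fill_eq B e1 e2)"

primrec boundary_of :: "'e jthesis \<Rightarrow> 'e bthesis" where
  "boundary_of (IsType A) = BdType"
| "boundary_of (IsTerm t A) = BdTerm A"
| "boundary_of (EqType A B) = BdEqType A B"
| "boundary_of (EqTerm s t A) = BdEqTerm s t A"


section \<open>Instantiations\<close>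

text \<open>\<open>is_inst \<Sigma> \<Theta> \<Gamma> \<Xi> I\<close>: \<open>I\<close> is an instantiation of \<open>\<Xi>\<close> over \<open>\<Theta>;\<Gamma>\<close>. The entries are listed in
  the order of \<open>\<Xi>\<close>, so that the restriction $I_{(k)}$ is \<open>take (k - 1) I\<close>.\<close>

definition is_inst ::
  "'s signature \<Rightarrow> 's mctx \<Rightarrow> 's vctx \<Rightarrow> 's mctx \<Rightarrow> 's inst_map \<Rightarrow> bool" where
  "is_inst \<Sigma> \<Theta> \<Gamma> \<Xi> I \<longleftrightarrow> map fst I = map fst \<Xi> \<and>
     (\<forall>i < length \<Xi>.
        valid_arg \<Sigma> (mv_arity \<Theta>) (dom_ctx \<Gamma>) 0 (arity_boundary (snd (\<Xi> ! i))) (snd (I ! i)))"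

text \<open>Arguments of an instantiation have no loose bound variables, so they need not be lifted
  under binders. Metavariables outside the domain of \<open>I\<close> are left in place.\<close>

primrec inst :: "'s inst_map \<Rightarrow> 's expr \<Rightarrow> 's expr" where
  "inst I (FVar a) = FVar a"
| "inst I (BVar i) = BVar i"
| "inst I (Sym S es) = Sym S (map (inst I) es)"
| "inst I (Meta M ts) =
     (case map_of I M of
        Some e \<Rightarrow> apply_arg e (map (inst I) ts)
      | None \<Rightarrow> Meta M (map (inst I) ts))"
| "inst I (Star c) = Star c"
| "inst I (Abs e) = Abs (inst I e)"

abbreviation inst_jthesis :: "'s inst_map \<Rightarrow> 's expr jthesis \<Rightarrow> 's expr jthesis" where
  "inst_jthesis I \<equiv> map_jthesis (inst I)"

abbreviation inst_bthesis :: "'s inst_map \<Rightarrow> 's expr bthesis \<Rightarrow> 's expr bthesis" where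
  "inst_bthesis I \<equiv> map_bthesis (inst I)"

primrec inst_judgement :: "'s inst_map \<Rightarrow> 's judgement \<Rightarrow> 's judgement" where
  "inst_judgement I (JThesis j) = JThesis (inst_jthesis I j)"
| "inst_judgement I (JAbs A J) = JAbs (inst I A) (inst_judgement I J)"

primrec inst_boundary :: "'s inst_map \<Rightarrow> 's boundary \<Rightarrow> 's boundary" where
  "inst_boundary I (BThesis b) = BThesis (inst_bthesis I b)"
| "inst_boundary I (BAbs A B) = BAbs (inst I A) (inst_boundary I B)"

text \<open>When the same \<open>\<Gamma>\<close> is a variable context both over \<open>\<Xi>\<close> and over \<open>\<Theta>\<close>, and the names of the
  metavariables of \<open>\<Xi>\<close> and \<open>\<Theta>\<close> are disjoint, \<open>\<Gamma>\<close> mentions no metavariables and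
  \<open>inst_vctx I \<Gamma> = \<Gamma>\<close>. If names are shared this equation is a genuine condition: for
  \<open>\<Gamma> = [a : M()]\<close> and $I = \langle M \mapsto N() \rangle$ the judgement $a : M()$ holds over
  \<open>\<Xi>;\<Gamma>\<close>, but $a : N()$ does not hold over \<open>\<Theta>;\<Gamma>\<close>.\<close>

definition inst_vctx :: "'s inst_map \<Rightarrow> 's vctx \<Rightarrow> 's vctx" where
  "inst_vctx I \<Gamma> = map (\<lambda>(a, A). (a, inst I A)) \<Gamma>"

text \<open>The judgement $(I_{(i)*}\mathcal{B}_i)[e_i]$, with \<open>i\<close> counted from 0.\<close>

definition inst_premise :: "'s inst_map \<Rightarrow> 's mctx \<Rightarrow> nat \<Rightarrow> 's judgement" where
  "inst_premise I \<Xi> i = fill (inst_boundary (take i I) (snd (\<Xi> ! i))) (snd (I ! i))"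

text \<open>The judgement $(I_{(i)*}\mathcal{B}_i)[f_i \equiv g_i]$, where $f_i$ and $g_i$ are the
  entries of \<open>I\<close> and \<open>K\<close>.\<close>

definition inst_eq_premise ::
  "'s inst_map \<Rightarrow> 's inst_map \<Rightarrow> 's mctx \<Rightarrow> nat \<Rightarrow> 's judgement" where
  "inst_eq_premise I K \<Xi> i =
     fill_eq (inst_boundary (take i I) (snd (\<Xi> ! i))) (snd (I ! i)) (snd (K ! i))"


section \<open>Raw type theories\<close>

text \<open>A raw rule $\Xi \Longrightarrow j$ is a hypothetical judgement $\Xi;[\,] \vdash j$ with
  non-abstracted conclusion. As derivability depends only on which rules are present, a family of
  rules is represented by the set of its members.\<close>

type_synonym 's raw_rule = "'s mctx \<times> 's expr jthesis"

definition is_raw_rule :: "'s signature \<Rightarrow> 's raw_rule \<Rightarrow> bool" where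
  "is_raw_rule \<Sigma> R \<longleftrightarrow>
     is_mctx \<Sigma> (fst R) \<and> valid_jthesis \<Sigma> (mv_arity (fst R)) {} 0 (snd R)"

definition raw_type_theory :: "'s signature \<Rightarrow> 's raw_rule set \<Rightarrow> bool" where
  "raw_type_theory \<Sigma> T \<longleftrightarrow> is_signature \<Sigma> \<and> (\<forall>R \<in> T. is_raw_rule \<Sigma> R)"

text \<open>\<open>deriv \<Sigma> T \<Theta> \<Gamma> J\<close> and \<open>deriv_bdry \<Sigma> T \<Theta> \<Gamma> B\<close>: derivability of $\Theta;\Gamma \vdash J$ and
  of $\Theta;\Gamma \vdash B$. The condition that \<open>a\<close> is not free in the body, in the abstraction
  rules, is what well-scopedness of the conclusion over \<open>\<Gamma>\<close> amounts to. The metavariable rule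
  and the rule for instances of specific rules have the boundary of their conclusion as a
  premise.\<close>

inductive
  deriv :: "'s signature \<Rightarrow> 's raw_rule set \<Rightarrow> 's mctx \<Rightarrow> 's vctx \<Rightarrow> 's judgement \<Rightarrow> bool" and
  deriv_bdry :: "'s signature \<Rightarrow> 's raw_rule set \<Rightarrow> 's mctx \<Rightarrow> 's vctx \<Rightarrow> 's boundary \<Rightarrow> bool"
  for \<Sigma> :: "'s signature" and T :: "'s raw_rule set" and \<Theta> :: "'s mctx"
where
  tt_var:
  "map_of \<Gamma> a = Some A \<Longrightarrow> deriv \<Sigma> T \<Theta> \<Gamma> (JThesis (IsTerm (FVar a) A))"
| tt_meta:
  "map_of \<Theta> M = Some (foldr BAbs As (BThesis b)) \<Longrightarrow> length ts = length As
   \<Longrightarrow> (\<forall>j < length As. deriv \<Sigma> T \<Theta> \<Gamma> (JThesis (IsTerm (ts ! j) (bsubsts (take j ts) (As ! j)))))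
   \<Longrightarrow> deriv_bdry \<Sigma> T \<Theta> \<Gamma> (BThesis (map_bthesis (bsubsts ts) b))
   \<Longrightarrow> deriv \<Sigma> T \<Theta> \<Gamma> (JThesis (fill_thesis (map_bthesis (bsubsts ts) b) (Meta M ts)))"
| tt_meta_congr:
  "map_of \<Theta> M = Some (foldr BAbs As (BThesis b)) \<Longrightarrow> class_bthesis b \<in> {Ty, Tm}
   \<Longrightarrow> length ss = length As \<Longrightarrow> length ts = length As
   \<Longrightarrow> (\<forall>j < length As. deriv \<Sigma> T \<Theta> \<Gamma> (JThesis (IsTerm (ss ! j) (bsubsts (take j ss) (As ! j)))))
   \<Longrightarrow> (\<forall>j < length As. deriv \<Sigma> T \<Theta> \<Gamma> (JThesis (IsTerm (ts ! j) (bsubsts (take j ts) (As ! j)))))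
   \<Longrightarrow> (\<forall>j < length As.
          deriv \<Sigma> T \<Theta> \<Gamma> (JThesis (EqTerm (ss ! j) (ts ! j) (bsubsts (take j ss) (As ! j)))))
   \<Longrightarrow> (\<forall>C. b = BdTerm C \<longrightarrow> deriv \<Sigma> T \<Theta> \<Gamma> (JThesis (EqType (bsubsts ss C) (bsubsts ts C))))
   \<Longrightarrow> deriv \<Sigma> T \<Theta> \<Gamma>
         (fill_eq (BThesis (map_bthesis (bsubsts ss) b)) (Meta M ss) (Meta M ts))"
| tt_abstr:
  "deriv \<Sigma> T \<Theta> \<Gamma> (JThesis (IsType A)) \<Longrightarrow> a \<notin> dom_ctx \<Gamma> \<Longrightarrow> a \<notin> fv_judgement J
   \<Longrightarrow> deriv \<Sigma> T \<Theta> (\<Gamma> @ [(a, A)]) (bsubst_judgement 0 (FVar a) J)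
   \<Longrightarrow> deriv \<Sigma> T \<Theta> \<Gamma> (JAbs A J)"
| tt_eqty_refl:
  "deriv \<Sigma> T \<Theta> \<Gamma> (JThesis (IsType A)) \<Longrightarrow> deriv \<Sigma> T \<Theta> \<Gamma> (JThesis (EqType A A))"
| tt_eqty_sym:
  "deriv \<Sigma> T \<Theta> \<Gamma> (JThesis (EqType A B)) \<Longrightarrow> deriv \<Sigma> T \<Theta> \<Gamma> (JThesis (EqType B A))"
| tt_eqty_trans:
  "deriv \<Sigma> T \<Theta> \<Gamma> (JThesis (EqType A B)) \<Longrightarrow> deriv \<Sigma> T \<Theta> \<Gamma> (JThesis (EqType B C))
   \<Longrightarrow> deriv \<Sigma> T \<Theta> \<Gamma> (JThesis (EqType A C))"
| tt_eqtm_refl: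
  "deriv \<Sigma> T \<Theta> \<Gamma> (JThesis (IsTerm t A)) \<Longrightarrow> deriv \<Sigma> T \<Theta> \<Gamma> (JThesis (EqTerm t t A))"
| tt_eqtm_sym:
  "deriv \<Sigma> T \<Theta> \<Gamma> (JThesis (EqTerm s t A)) \<Longrightarrow> deriv \<Sigma> T \<Theta> \<Gamma> (JThesis (EqTerm t s A))"
| tt_eqtm_trans:
  "deriv \<Sigma> T \<Theta> \<Gamma> (JThesis (EqTerm s t A)) \<Longrightarrow> deriv \<Sigma> T \<Theta> \<Gamma> (JThesis (EqTerm t u A))
   \<Longrightarrow> deriv \<Sigma> T \<Theta> \<Gamma> (JThesis (EqTerm s u A))"
| tt_conv_tm:
  "deriv \<Sigma> T \<Theta> \<Gamma> (JThesis (IsTerm t A)) \<Longrightarrow> deriv \<Sigma> T \<Theta> \<Gamma> (JThesis (EqType A B))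
   \<Longrightarrow> deriv \<Sigma> T \<Theta> \<Gamma> (JThesis (IsTerm t B))"
| tt_conv_eqtm:
  "deriv \<Sigma> T \<Theta> \<Gamma> (JThesis (EqTerm s t A)) \<Longrightarrow> deriv \<Sigma> T \<Theta> \<Gamma> (JThesis (EqType A B))
   \<Longrightarrow> deriv \<Sigma> T \<Theta> \<Gamma> (JThesis (EqTerm s t B))"
| tt_rule:
  "(\<Xi>, j) \<in> T \<Longrightarrow> is_inst \<Sigma> \<Theta> \<Gamma> \<Xi> I
   \<Longrightarrow> (\<forall>i < length \<Xi>. deriv \<Sigma> T \<Theta> \<Gamma> (inst_premise I \<Xi> i))
   \<Longrightarrow> deriv_bdry \<Sigma> T \<Theta> \<Gamma> (BThesis (inst_bthesis I (boundary_of j)))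
   \<Longrightarrow> deriv \<Sigma> T \<Theta> \<Gamma> (JThesis (inst_jthesis I j))"
| tt_congr_ty:
  "(\<Xi>, IsType A) \<in> T \<Longrightarrow> is_inst \<Sigma> \<Theta> \<Gamma> \<Xi> I \<Longrightarrow> is_inst \<Sigma> \<Theta> \<Gamma> \<Xi> K
   \<Longrightarrow> (\<forall>i < length \<Xi>. deriv \<Sigma> T \<Theta> \<Gamma> (inst_premise I \<Xi> i))
   \<Longrightarrow> (\<forall>i < length \<Xi>. deriv \<Sigma> T \<Theta> \<Gamma> (inst_premise K \<Xi> i))
   \<Longrightarrow> (\<forall>i < length \<Xi>. object_boundary (snd (\<Xi> ! i))
          \<longrightarrow> deriv \<Sigma> T \<Theta> \<Gamma> (inst_eq_premise I K \<Xi> i))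
   \<Longrightarrow> deriv \<Sigma> T \<Theta> \<Gamma> (JThesis (EqType (inst I A) (inst K A)))"
| tt_congr_tm:
  "(\<Xi>, IsTerm t A) \<in> T \<Longrightarrow> is_inst \<Sigma> \<Theta> \<Gamma> \<Xi> I \<Longrightarrow> is_inst \<Sigma> \<Theta> \<Gamma> \<Xi> K
   \<Longrightarrow> (\<forall>i < length \<Xi>. deriv \<Sigma> T \<Theta> \<Gamma> (inst_premise I \<Xi> i))
   \<Longrightarrow> (\<forall>i < length \<Xi>. deriv \<Sigma> T \<Theta> \<Gamma> (inst_premise K \<Xi> i))
   \<Longrightarrow> (\<forall>i < length \<Xi>. object_boundary (snd (\<Xi> ! i))
          \<longrightarrow> deriv \<Sigma> T \<Theta> \<Gamma> (inst_eq_premise I K \<Xi> i))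
   \<Longrightarrow> deriv \<Sigma> T \<Theta> \<Gamma> (JThesis (EqType (inst I A) (inst K A)))
   \<Longrightarrow> deriv \<Sigma> T \<Theta> \<Gamma> (JThesis (EqTerm (inst I t) (inst K t) (inst I A)))"
| bdry_ty:
  "deriv_bdry \<Sigma> T \<Theta> \<Gamma> (BThesis BdType)"
| bdry_tm:
  "deriv \<Sigma> T \<Theta> \<Gamma> (JThesis (IsType A)) \<Longrightarrow> deriv_bdry \<Sigma> T \<Theta> \<Gamma> (BThesis (BdTerm A))"
| bdry_eqty:
  "deriv \<Sigma> T \<Theta> \<Gamma> (JThesis (IsType A)) \<Longrightarrow> deriv \<Sigma> T \<Theta> \<Gamma> (JThesis (IsType B))
   \<Longrightarrow> deriv_bdry \<Sigma> T \<Theta> \<Gamma> (BThesis (BdEqType A B))"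
| bdry_eqtm:
  "deriv \<Sigma> T \<Theta> \<Gamma> (JThesis (IsType A)) \<Longrightarrow> deriv \<Sigma> T \<Theta> \<Gamma> (JThesis (IsTerm s A))
   \<Longrightarrow> deriv \<Sigma> T \<Theta> \<Gamma> (JThesis (IsTerm t A))
   \<Longrightarrow> deriv_bdry \<Sigma> T \<Theta> \<Gamma> (BThesis (BdEqTerm s t A))"
| bdry_abstr:
  "deriv \<Sigma> T \<Theta> \<Gamma> (JThesis (IsType A)) \<Longrightarrow> a \<notin> dom_ctx \<Gamma> \<Longrightarrow> a \<notin> fv_boundary B
   \<Longrightarrow> deriv_bdry \<Sigma> T \<Theta> (\<Gamma> @ [(a, A)]) (bsubst_boundary 0 (FVar a) B)
   \<Longrightarrow> deriv_bdry \<Sigma> T \<Theta> \<Gamma> (BAbs A B)"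

definition derivable_inst ::
  "'s signature \<Rightarrow> 's raw_rule set \<Rightarrow> 's mctx \<Rightarrow> 's vctx \<Rightarrow> 's mctx \<Rightarrow> 's inst_map \<Rightarrow> bool" where
  "derivable_inst \<Sigma> T \<Theta> \<Gamma> \<Xi> I \<longleftrightarrow>
     is_inst \<Sigma> \<Theta> \<Gamma> \<Xi> I \<and> (\<forall>i < length \<Xi>. deriv \<Sigma> T \<Theta> \<Gamma> (inst_premise I \<Xi> i))"

end

theory Submission
  imports Defs
begin

text \<open>Substitution for free variables and instantiation of metavariables are two cases of one
  simultaneous action \<open>act I \<sigma>\<close>, and every rule except the two metavariable rules is stable under
  any well-typed action, for the same reason. Renamings give weakening, then derivable terms give
  admissibility of substitution. Judgementally equal substitutions \<open>\<sigma>\<close> and \<open>\<tau>\<close> moreover take a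
  derivable object judgement to a derivable equation: the congruence rules apply, since both
  instances of their premises are derivable by substitution. For an instantiation, a metavariable
  $\mathsf{M}(t_1,\ldots,t_m)$ becomes an instance of the body of a derivable abstracted judgement, so
  the metavariable rule follows from substitution and its congruence rule from equality of
  substitutions.\<close>

section \<open>De Bruijn calculus\<close>

text \<open>Derivability of an instantiation speaks of abstracted judgements, whereas an occurrence
  of a metavariable needs their body at particular terms. The binders cannot be instantiated
  directly: inverting the abstraction rule gives a body opened with a fresh name that the derivation
  has chosen. Substitution for free variables must therefore be available over
  \<open>\<Theta>\<close> before metavariables can be treated. A chosen name may also clash with the
  target context, so derivability under an action is proved for all target contexts and actions at
  once, which permits renaming. The congruence rules for terms also demand an equation between the
  two instances of the type. The boundary premises of the metavariable rule and of specific rules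
  provide it, which is why the statement on equal substitutions has a clause for boundaries.
  Finally, moving expressions under binders without lifting is correct only if they have no loose
  indices. Derivable judgements over well-scoped contexts are shown to be well scoped, and this
  justifies every calculation with indices inside the inductions.\<close>

lemma lift_lift: "i \<le> k \<Longrightarrow> lift i (lift k e) = lift (Suc k) (lift i e)"
  by (induction e arbitrary: i k) auto

lemma bsubst_lift [simp]: "bsubst k u (lift k e) = e"
  by (induction e arbitrary: k u) (auto simp: map_idI)

lemma lift_bsubst_le: "i \<le> k \<Longrightarrow> lift i (bsubst k u e) = bsubst (Suc k) (lift i u) (lift i e)"
  by (induction e arbitrary: i k u) (auto simp: lift_lift)

lemma lift_bsubst_ge: "k \<le> i \<Longrightarrow> lift i (bsubst k u e) = bsubst k (lift i u) (lift (Suc i) e)"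
  by (induction e arbitrary: i k u) (auto simp: lift_lift)

text \<open>Eliminating index \<open>j\<close> lowers the variable \<open>Suc k\<close> to
  \<open>k\<close>, which explains the different indices on the two sides. The term \<open>u\<close>
  lives outside the scope of \<open>j\<close> and is lifted over it when substituted first.\<close>

lemma bsubst_bsubst:
  "j \<le> k \<Longrightarrow> bsubst k u (bsubst j t e) = bsubst j (bsubst k u t) (bsubst (Suc k) (lift j u) e)"
  by (induction e arbitrary: j k u t) (auto simp: lift_lift lift_bsubst_le)

lemma bsubst_funpow_Abs:
  "bsubst k u ((Abs ^^ n) e) = (Abs ^^ n) (bsubst (n + k) ((lift 0 ^^ n) u) e)"
  by (induction n arbitrary: k u) (auto simp: funpow_swap1[of "lift 0"])

text \<open>In the default case of \<open>apply_arg\<close>, substitution can turn a bound variable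
  into an abstraction that then consumes the remaining arguments. Commutation of
  \<open>bsubst\<close> with \<open>apply_arg\<close> therefore asks for all abstractions to be
  present from the start.\<close>

primrec has_abs :: "nat \<Rightarrow> 's expr \<Rightarrow> bool" where
  "has_abs 0 e \<longleftrightarrow> True"
| "has_abs (Suc n) e \<longleftrightarrow> (\<exists>e1. e = Abs e1 \<and> has_abs n e1)"

lemma has_abs_funpow_Abs [simp]: "has_abs n ((Abs ^^ n) e)"
  by (induction n) auto

lemma has_abs_bsubst: "has_abs n e \<Longrightarrow> has_abs n (bsubst k u e)"
  by (induction n arbitrary: e k u) auto

lemma lift_apply_arg:
  "has_abs (length ts) e \<Longrightarrow> lift k (apply_arg e ts) = apply_arg (lift k e) (map (lift k) ts)"
  by (induction ts arbitrary: e) (auto simp: lift_bsubst_ge has_abs_bsubst)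

lemma bsubst_apply_arg:
  "has_abs (length ts) e \<Longrightarrow>
    bsubst k u (apply_arg e ts) = apply_arg (bsubst k u e) (map (bsubst k u) ts)"
  by (induction ts arbitrary: e) (auto simp: bsubst_bsubst has_abs_bsubst)


section \<open>Validity\<close>

inductive_cases valid_FVarE: "valid_arg \<Sigma> \<Phi> V d ar (FVar a)"
inductive_cases valid_BVarE: "valid_arg \<Sigma> \<Phi> V d ar (BVar i)"
inductive_cases valid_SymE: "valid_arg \<Sigma> \<Phi> V d ar (Sym S es)"
inductive_cases valid_MetaE: "valid_arg \<Sigma> \<Phi> V d ar (Meta M ts)"
inductive_cases valid_StarE: "valid_arg \<Sigma> \<Phi> V d ar (Star c)"
inductive_cases valid_AbsE: "valid_arg \<Sigma> \<Phi> V d ar (Abs e)"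
inductive_cases valid_SucE: "valid_arg \<Sigma> \<Phi> V d (c, Suc n) e"

lemma valid_mono:
  "valid_arg \<Sigma> \<Phi> V d ar e \<Longrightarrow> V \<subseteq> V' \<Longrightarrow> d \<le> d' \<Longrightarrow> \<Phi> \<subseteq>\<^sub>m \<Phi>' \<Longrightarrow> valid_arg \<Sigma> \<Phi>' V' d' ar e"
proof (induction arbitrary: d' rule: valid_arg.induct)
  case (valid_Sym S c as d es)
  then show ?case by (auto intro!: valid_arg.valid_Sym elim!: list_all2_mono)
next
  case (valid_Meta M c ts d)
  then show ?case by (auto intro!: valid_arg.valid_Meta simp: map_le_def dom_def)
qed (auto intro: valid_arg.intros)

lemma valid_fv: "valid_arg \<Sigma> \<Phi> V d ar e \<Longrightarrow> fv e \<subseteq> V"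
proof (induction rule: valid_arg.induct)
  case (valid_Sym S c as d es)
  then show ?case by (auto simp: list_all2_conv_all_nth in_set_conv_nth) blast
qed auto

lemma valid_lift_id: "valid_arg \<Sigma> \<Phi> V d ar e \<Longrightarrow> d \<le> k \<Longrightarrow> lift k e = e"
proof (induction arbitrary: k rule: valid_arg.induct)
  case (valid_Sym S c as d es)
  then show ?case by (auto intro!: map_idI simp: list_all2_conv_all_nth in_set_conv_nth)
qed (auto intro!: map_idI)

lemma valid_bsubst_id: "valid_arg \<Sigma> \<Phi> V d ar e \<Longrightarrow> d \<le> k \<Longrightarrow> bsubst k u e = e"
proof (induction arbitrary: k u rule: valid_arg.induct)
  case (valid_Sym S c as d es)
  then show ?case by (auto intro!: map_idI simp: list_all2_conv_all_nth in_set_conv_nth)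
qed (auto intro!: map_idI)

lemma valid_funpow_Abs:
  "valid_arg \<Sigma> \<Phi> V d (c, m) ((Abs ^^ n) e) \<longleftrightarrow> n \<le> m \<and> valid_arg \<Sigma> \<Phi> V (n + d) (c, m - n) e"
proof (induction n arbitrary: d m)
  case (Suc n)
  then show ?case
    by (cases m) (auto elim: valid_AbsE intro: valid_arg.intros)
qed simp

lemma valid_has_abs: "valid_arg \<Sigma> \<Phi> V d (c, n) e \<Longrightarrow> has_abs n e"
  by (induction n arbitrary: d e) (auto elim: valid_SucE)

lemma valid_lift: "valid_arg \<Sigma> \<Phi> V d ar e \<Longrightarrow> valid_arg \<Sigma> \<Phi> V (Suc d) ar (lift k e)"
proof (induction arbitrary: k rule: valid_arg.induct)
  case (valid_Sym S c as d es)
  then show ?case by (auto intro!: valid_arg.valid_Sym simp: list_all2_conv_all_nth)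
next
  case (valid_Meta M c ts d)
  then show ?case by (auto intro!: valid_arg.valid_Meta)
qed (auto intro: valid_arg.intros)

lemma valid_bsubst:
  "valid_arg \<Sigma> \<Phi> V d' ar e \<Longrightarrow> d' = Suc d \<Longrightarrow> k \<le> d \<Longrightarrow> valid_tm \<Sigma> \<Phi> V d u
    \<Longrightarrow> valid_arg \<Sigma> \<Phi> V d ar (bsubst k u e)"
proof (induction arbitrary: d k u rule: valid_arg.induct)
  case (valid_Sym S c as d es)
  then show ?case by (auto intro!: valid_arg.valid_Sym simp: list_all2_conv_all_nth)
next
  case (valid_Meta M c ts d)
  then show ?case by (auto intro!: valid_arg.valid_Meta)
next
  case (valid_Abs d' c n e)
  then show ?case by (auto intro!: valid_arg.valid_Abs simp: valid_lift)
qed (auto intro: valid_arg.intros)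

text \<open>Since \<open>a\<close> does not occur in \<open>e\<close>, every \<open>FVar a\<close>
  in the opened expression comes from index \<open>k\<close>. This recovers scoping of the body of
  an abstraction from the premise of the abstraction rule, which only sees the opened body.\<close>

lemma valid_bsubst_FVar_cancel:
  "valid_arg \<Sigma> \<Phi> (insert a V) d ar (bsubst k (FVar a) e) \<Longrightarrow> a \<notin> fv e \<Longrightarrow> k \<le> d
    \<Longrightarrow> valid_arg \<Sigma> \<Phi> V (Suc d) ar e"
proof (induction e arbitrary: d ar k)
  case (BVar i)
  then show ?case
    by (auto split: if_splits elim!: valid_BVarE valid_FVarE intro!: valid_arg.intros)
next
  case (Sym S es)
  then show ?case
    by (auto elim!: valid_SymE intro!: valid_arg.valid_Sym simp: list_all2_conv_all_nth)
      (metis nth_mem surj_pair)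
next
  case (Meta M ts)
  then show ?case
    by (auto elim!: valid_MetaE intro!: valid_arg.valid_Meta) blast+
qed (auto elim!: valid_FVarE valid_StarE valid_AbsE intro!: valid_arg.intros)

lemma valid_apply_arg:
  "valid_arg \<Sigma> \<Phi> V d (c, length ts) e \<Longrightarrow> (\<forall>t \<in> set ts. valid_tm \<Sigma> \<Phi> V d t)
    \<Longrightarrow> valid_arg \<Sigma> \<Phi> V d (c, 0) (apply_arg e ts)"
proof (induction ts arbitrary: e)
  case (Cons t ts)
  then obtain e1 where "e = Abs e1" "valid_arg \<Sigma> \<Phi> V (Suc d) (c, length ts) e1"
    by (auto elim: valid_SucE)
  with Cons show ?case by (auto intro: valid_bsubst)
qed simp

lemma bsubsts_Nil [simp]: "bsubsts [] e = e"
  by (simp add: bsubsts_def)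

text \<open>The first variable of the telescope lies beneath \<open>length ts\<close> further
  binders, hence the index. The repeated lifting of \<open>t\<close> on the way there is the
  identity because \<open>t\<close> has no loose indices.\<close>

lemma bsubsts_Cons:
  assumes "valid_tm \<Sigma> \<Phi> V 0 t"
  shows "bsubsts (t # ts) e = bsubsts ts (bsubst (length ts) t e)"
proof -
  have "(lift 0 ^^ n) t = t" for n
    using valid_lift_id[OF assms] by (induction n) auto
  then show ?thesis by (simp add: bsubsts_def bsubst_funpow_Abs)
qed

section \<open>Scoping of judgements, boundaries and telescopes\<close>

primrec valid_judgement ::
  "'s signature \<Rightarrow> (mvar \<rightharpoonup> arity) \<Rightarrow> fvar set \<Rightarrow> nat \<Rightarrow> 's judgement \<Rightarrow> bool" where
  "valid_judgement \<Sigma> \<Phi> V d (JThesis j) \<longleftrightarrow> valid_jthesis \<Sigma> \<Phi> V d j"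
| "valid_judgement \<Sigma> \<Phi> V d (JAbs A J) \<longleftrightarrow>
     valid_ty \<Sigma> \<Phi> V d A \<and> valid_judgement \<Sigma> \<Phi> V (Suc d) J"

lemma valid_judgement_fv: "valid_judgement \<Sigma> \<Phi> V d J \<Longrightarrow> fv_judgement J \<subseteq> V"
proof (induction J arbitrary: d)
  case (JThesis j)
  then show ?case by (cases j) (auto dest: valid_fv)
qed (force dest: valid_fv)

lemma valid_boundary_fv: "valid_boundary \<Sigma> \<Phi> V d B \<Longrightarrow> fv_boundary B \<subseteq> V"
proof (induction B arbitrary: d)
  case (BThesis b)
  then show ?case by (cases b) (auto dest: valid_fv)
qed (force dest: valid_fv)

lemma valid_judgement_bsubst_FVar_cancel:
  "valid_judgement \<Sigma> \<Phi> (insert a V) d (bsubst_judgement k (FVar a) J) \<Longrightarrow> a \<notin> fv_judgement J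
    \<Longrightarrow> k \<le> d \<Longrightarrow> valid_judgement \<Sigma> \<Phi> V (Suc d) J"
proof (induction J arbitrary: k d)
  case (JThesis j)
  then show ?case by (cases j) (auto intro: valid_bsubst_FVar_cancel)
qed (auto intro: valid_bsubst_FVar_cancel)

lemma valid_boundary_bsubst_FVar_cancel:
  "valid_boundary \<Sigma> \<Phi> (insert a V) d (bsubst_boundary k (FVar a) B) \<Longrightarrow> a \<notin> fv_boundary B
    \<Longrightarrow> k \<le> d \<Longrightarrow> valid_boundary \<Sigma> \<Phi> V (Suc d) B"
proof (induction B arbitrary: k d)
  case (BThesis b)
  then show ?case by (cases b) (auto intro: valid_bsubst_FVar_cancel)
qed (auto intro: valid_bsubst_FVar_cancel)

lemma valid_boundary_foldr_BAbs:
  "valid_boundary \<Sigma> \<Phi> V d (foldr BAbs As B) \<longleftrightarrow>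
    (\<forall>j < length As. valid_ty \<Sigma> \<Phi> V (j + d) (As ! j)) \<and> valid_boundary \<Sigma> \<Phi> V (length As + d) B"
  by (induction As arbitrary: d) (auto simp: All_less_Suc2)

lemma arity_boundary_foldr_BAbs [simp]:
  "arity_boundary (foldr BAbs As (BThesis b)) = (class_bthesis b, length As)"
  by (induction As) (auto simp: arity_boundary_def)


section \<open>Simultaneous substitution and instantiation\<close>

text \<open>\<open>act I FVar\<close> is instantiation and \<open>act [] \<sigma>\<close> is
  substitution for free variables. Nothing is lifted under \<open>Abs\<close>: the images of
  variables and the entries of \<open>I\<close> are meant to have no loose indices, as
  \<open>act_ok\<close> demands.\<close>

primrec act :: "'s inst_map \<Rightarrow> (fvar \<Rightarrow> 's expr) \<Rightarrow> 's expr \<Rightarrow> 's expr" where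
  "act I \<sigma> (FVar a) = \<sigma> a"
| "act I \<sigma> (BVar i) = BVar i"
| "act I \<sigma> (Sym S es) = Sym S (map (act I \<sigma>) es)"
| "act I \<sigma> (Meta M ts) =
     (case map_of I M of
        Some e \<Rightarrow> apply_arg e (map (act I \<sigma>) ts)
      | None \<Rightarrow> Meta M (map (act I \<sigma>) ts))"
| "act I \<sigma> (Star c) = Star c"
| "act I \<sigma> (Abs e) = Abs (act I \<sigma> e)"

text \<open>Scoping of an action from \<open>\<Phi>\<close>, \<open>V\<close> to
  \<open>\<Phi>'\<close>, \<open>V'\<close>. Depth 0 is what allows images to be placed under
  binders as they stand. The last clause concerns metavariables that \<open>I\<close> leaves in
  place, which must keep their arity in the target.\<close>

definition act_ok ::
  "'s signature \<Rightarrow> (mvar \<rightharpoonup> arity) \<Rightarrow> fvar set \<Rightarrow> (mvar \<rightharpoonup> arity) \<Rightarrow> fvar set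
    \<Rightarrow> 's inst_map \<Rightarrow> (fvar \<Rightarrow> 's expr) \<Rightarrow> bool" where
  "act_ok \<Sigma> \<Phi> V \<Phi>' V' I \<sigma> \<longleftrightarrow>
     (\<forall>a \<in> V. valid_tm \<Sigma> \<Phi>' V' 0 (\<sigma> a)) \<and>
     (\<forall>M ar e. \<Phi> M = Some ar \<longrightarrow> map_of I M = Some e \<longrightarrow> valid_arg \<Sigma> \<Phi>' V' 0 ar e) \<and>
     (\<forall>M ar. \<Phi> M = Some ar \<longrightarrow> map_of I M = None \<longrightarrow> \<Phi>' M = Some ar)"

lemma inst_eq_act: "inst I = act I FVar"
proof
  show "inst I e = act I FVar e" for e
    by (induction e) (auto split: option.split cong: map_cong)
qed

lemma inst_Nil [simp]: "inst [] e = e"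
  by (induction e) (auto simp: map_idI)

lemma act_Nil_FVar [simp]: "act [] FVar e = e"
  by (metis inst_Nil inst_eq_act)

lemma act_ok_FVar: "act_ok \<Sigma> \<Phi> V \<Phi>' V' I \<sigma> \<Longrightarrow> a \<in> V \<Longrightarrow> valid_tm \<Sigma> \<Phi>' V' 0 (\<sigma> a)"
  by (simp add: act_ok_def)

lemma act_ok_Some:
  "act_ok \<Sigma> \<Phi> V \<Phi>' V' I \<sigma> \<Longrightarrow> \<Phi> M = Some ar \<Longrightarrow> map_of I M = Some e \<Longrightarrow> valid_arg \<Sigma> \<Phi>' V' 0 ar e"
  unfolding act_ok_def by blast

lemma act_ok_None:
  "act_ok \<Sigma> \<Phi> V \<Phi>' V' I \<sigma> \<Longrightarrow> \<Phi> M = Some ar \<Longrightarrow> map_of I M = None \<Longrightarrow> \<Phi>' M = Some ar"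
  unfolding act_ok_def by blast

lemma act_ok_mono: "act_ok \<Sigma> \<Phi> V \<Phi>' V' I \<sigma> \<Longrightarrow> V' \<subseteq> W \<Longrightarrow> act_ok \<Sigma> \<Phi> V \<Phi>' W I \<sigma>"
  unfolding act_ok_def by (blast intro: valid_mono[OF _ _ le_refl map_le_refl])

lemma act_ok_upd:
  "act_ok \<Sigma> \<Phi> V \<Phi>' V' I \<sigma> \<Longrightarrow> valid_tm \<Sigma> \<Phi>' V' 0 t
    \<Longrightarrow> act_ok \<Sigma> \<Phi> (insert a V) \<Phi>' V' I (\<sigma>(a := t))"
  by (auto simp: act_ok_def)

lemma act_ok_Nil: "act_ok \<Sigma> \<Phi> V \<Phi> V' [] \<sigma> \<longleftrightarrow> (\<forall>a \<in> V. valid_tm \<Sigma> \<Phi> V' 0 (\<sigma> a))"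
  by (auto simp: act_ok_def)

lemma act_cong:
  "valid_arg \<Sigma> \<Phi> V d ar e \<Longrightarrow> (\<And>a. a \<in> V \<Longrightarrow> \<sigma> a = \<tau> a)
    \<Longrightarrow> (\<And>M. M \<in> dom \<Phi> \<Longrightarrow> map_of I M = map_of K M) \<Longrightarrow> act I \<sigma> e = act K \<tau> e"
proof (induction rule: valid_arg.induct)
  case (valid_Sym S c as d es)
  then show ?case by (auto simp: list_all2_conv_all_nth in_set_conv_nth)
next
  case (valid_Meta M c ts d)
  then have "map (act I \<sigma>) ts = map (act K \<tau>) ts" "map_of I M = map_of K M" by auto
  then show ?case by (simp split: option.split del: map_eq_conv)
qed auto

lemma act_upd_fresh:
  "valid_arg \<Sigma> \<Phi> V d ar e \<Longrightarrow> a \<notin> V \<Longrightarrow> act I (\<sigma>(a := t)) e = act I \<sigma> e"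
  by (rule act_cong) auto

lemma act_valid:
  "valid_arg \<Sigma> \<Phi> V d ar e \<Longrightarrow> act_ok \<Sigma> \<Phi> V \<Phi>' V' I \<sigma> \<Longrightarrow> valid_arg \<Sigma> \<Phi>' V' d ar (act I \<sigma> e)"
proof (induction rule: valid_arg.induct)
  case (valid_Sym S c as d es)
  then show ?case by (auto intro!: valid_arg.valid_Sym simp: list_all2_conv_all_nth)
next
  case (valid_Meta M c ts d)
  then have ts: "\<forall>t \<in> set (map (act I \<sigma>) ts). valid_tm \<Sigma> \<Phi>' V' d t" by auto
  show ?case
  proof (cases "map_of I M")
    case None
    then have "\<Phi>' M = Some (c, length ts)" using valid_Meta(1,4) by (auto intro: act_ok_None)
    then show ?thesis using None valid_Meta(2) ts by (auto intro!: valid_arg.valid_Meta)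
  next
    case (Some e)
    then have "valid_arg \<Sigma> \<Phi>' V' 0 (c, length ts) e"
      using valid_Meta(1,4) by (auto intro: act_ok_Some)
    then have "valid_arg \<Sigma> \<Phi>' V' d (c, length (map (act I \<sigma>) ts)) e"
      by (auto elim: valid_mono)
    from valid_apply_arg[OF this ts] show ?thesis using Some by simp
  qed
next
  case (valid_FVar a d)
  then show ?case by (auto intro: valid_mono[OF act_ok_FVar])
qed (auto intro: valid_arg.intros)

lemma act_ok_has_abs:
  assumes "act_ok \<Sigma> \<Phi> V \<Phi>' V' I \<sigma>" "\<Phi> M = Some (c, n)" "map_of I M = Some e"
  shows "has_abs n e" "lift k e = e" "bsubst k u e = e"
proof -
  have "valid_arg \<Sigma> \<Phi>' V' 0 (c, n) e"
    using assms by (rule act_ok_Some)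
  then show "has_abs n e" "lift k e = e" "bsubst k u e = e"
    by (auto intro: valid_has_abs valid_lift_id valid_bsubst_id)
qed

lemma act_lift:
  "valid_arg \<Sigma> \<Phi> V d ar e \<Longrightarrow> act_ok \<Sigma> \<Phi> V \<Phi>' V' I \<sigma> \<Longrightarrow> act I \<sigma> (lift k e) = lift k (act I \<sigma> e)"
proof (induction arbitrary: k rule: valid_arg.induct)
  case (valid_FVar a d)
  then show ?case using valid_lift_id[OF act_ok_FVar[OF valid_FVar(2,1)]] by simp
next
  case (valid_Sym S c as d es)
  then show ?case by (auto simp: list_all2_conv_all_nth in_set_conv_nth)
next
  case (valid_Meta M c ts d)
  then have "map (act I \<sigma> \<circ> lift k) ts = map (lift k \<circ> act I \<sigma>) ts" by simp
  then show ?case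
    using act_ok_has_abs[OF valid_Meta(4,1)] by (auto simp: lift_apply_arg split: option.split simp del: map_eq_conv)
qed auto

text \<open>Images of free variables and entries of \<open>I\<close> contain no loose index, so
  \<open>bsubst\<close> leaves them fixed. At a metavariable the two operations meet in
  \<open>bsubst_apply_arg\<close>, and at a binder the lifted \<open>u\<close> is handled by
  \<open>act_lift\<close>.\<close>

lemma act_bsubst:
  "valid_arg \<Sigma> \<Phi> V d ar e \<Longrightarrow> act_ok \<Sigma> \<Phi> V \<Phi>' V' I \<sigma> \<Longrightarrow> valid_arg \<Sigma> \<Phi> V d' ar' u
    \<Longrightarrow> act I \<sigma> (bsubst k u e) = bsubst k (act I \<sigma> u) (act I \<sigma> e)"
proof (induction arbitrary: k u d' rule: valid_arg.induct)
  case (valid_FVar a d)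
  then show ?case using valid_bsubst_id[OF act_ok_FVar[OF valid_FVar(2,1)]] by simp
next
  case (valid_Sym S c as d es)
  then show ?case by (auto simp: list_all2_conv_all_nth in_set_conv_nth) blast
next
  case (valid_Meta M c ts d)
  then have "map (act I \<sigma> \<circ> bsubst k u) ts = map (bsubst k (act I \<sigma> u) \<circ> act I \<sigma>) ts" by auto
  then show ?case
    using act_ok_has_abs[OF valid_Meta(4,1)] by (auto simp: bsubst_apply_arg split: option.split simp del: map_eq_conv)
next
  case (valid_Abs d c n e)
  have "act I \<sigma> (bsubst (Suc k) (lift 0 u) e) = bsubst (Suc k) (act I \<sigma> (lift 0 u)) (act I \<sigma> e)"
    using valid_Abs.IH[OF valid_Abs.prems(1) valid_lift[OF valid_Abs.prems(2)]] .
  then show ?case by (simp add: act_lift[OF valid_Abs.prems(2,1)])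
qed auto

text \<open>This trades bound variables for free ones: a binder opened with a fresh name
  \<open>a\<close> can be given any value \<open>t\<close> afterwards by updating the substitution.
  With \<open>t\<close> a variable it renames under abstractions; with an arbitrary \<open>t\<close>
  it evaluates telescopes.\<close>

lemma act_bsubst_FVar:
  assumes "valid_arg \<Sigma> \<Phi> V d ar e" "a \<notin> V" "act_ok \<Sigma> \<Phi> V \<Phi>' V' I \<sigma>" "valid_tm \<Sigma> \<Phi>' V' 0 t"
  shows "act I (\<sigma>(a := t)) (bsubst k (FVar a) e) = bsubst k t (act I \<sigma> e)"
proof -
  have "valid_arg \<Sigma> \<Phi> (insert a V) d ar e"
    using assms(1) by (auto elim: valid_mono)
  from act_bsubst[OF this act_ok_upd[OF assms(3,4)] valid_FVar[OF insertI1]]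
  have "act I (\<sigma>(a := t)) (bsubst k (FVar a) e) = bsubst k t (act I (\<sigma>(a := t)) e)" by simp
  also have "act I (\<sigma>(a := t)) e = act I \<sigma> e"
    using assms(1) by (rule act_cong) (use assms(2) in auto)
  finally show ?thesis .
qed

lemma act_apply_arg:
  "valid_arg \<Sigma> \<Phi> V d (c, length ts) e \<Longrightarrow> act_ok \<Sigma> \<Phi> V \<Phi>' V' I \<sigma>
    \<Longrightarrow> (\<forall>t \<in> set ts. valid_tm \<Sigma> \<Phi> V d t)
    \<Longrightarrow> act I \<sigma> (apply_arg e ts) = apply_arg (act I \<sigma> e) (map (act I \<sigma>) ts)"
proof (induction ts arbitrary: e)
  case (Cons t ts)
  then obtain e1 where e1: "e = Abs e1" "valid_arg \<Sigma> \<Phi> V (Suc d) (c, length ts) e1"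
    by (auto elim: valid_SucE)
  moreover have "valid_arg \<Sigma> \<Phi> V d (c, length ts) (bsubst 0 t e1)"
    using e1 Cons.prems by (auto intro: valid_bsubst)
  ultimately show ?case
    using Cons by (auto simp: act_bsubst)
qed simp

lemma act_funpow_Abs: "act I \<sigma> ((Abs ^^ n) e) = (Abs ^^ n) (act I \<sigma> e)"
  by (induction n) auto

lemma act_bsubsts:
  assumes "valid_arg \<Sigma> \<Phi> V (length ts) (c, 0) e" "act_ok \<Sigma> \<Phi> V \<Phi>' V' I \<sigma>"
    "\<forall>t \<in> set ts. valid_tm \<Sigma> \<Phi> V 0 t"
  shows "act I \<sigma> (bsubsts ts e) = bsubsts (map (act I \<sigma>) ts) (act I \<sigma> e)"
proof -
  have "valid_arg \<Sigma> \<Phi> V 0 (c, length ts) ((Abs ^^ length ts) e)"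
    using assms(1) by (simp add: valid_funpow_Abs)
  from act_apply_arg[OF this assms(2,3)] show ?thesis
    by (simp add: bsubsts_def act_funpow_Abs)
qed

section \<open>Composition of an action with an instantiation\<close>

definition map_inst :: "('s expr \<Rightarrow> 's expr) \<Rightarrow> 's inst_map \<Rightarrow> 's inst_map" where
  "map_inst f K = map (\<lambda>(M, e). (M, f e)) K"

lemma map_of_map_inst [simp]: "map_of (map_inst f K) M = map_option f (map_of K M)"
  by (simp add: map_inst_def map_of_map)

lemma map_fst_map_inst [simp]: "map fst (map_inst f K) = map fst K"
  by (auto simp: map_inst_def)

lemma take_map_inst: "take i (map_inst f K) = map_inst f (take i K)"
  by (simp add: map_inst_def take_map)

lemma snd_nth_map_inst: "i < length K \<Longrightarrow> snd (map_inst f K ! i) = f (snd (K ! i))"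
  by (simp add: map_inst_def case_prod_beta)

text \<open>The expression \<open>e\<close> has no free variables and \<open>K\<close> replaces all
  its metavariables, so the outer action meets only the entries of \<open>K\<close>. Rules are
  stated by such expressions; hence acting on an instance of a rule gives another instance of the
  same rule.\<close>

lemma act_inst:
  "valid_arg \<Sigma> \<Phi> {} d ar e \<Longrightarrow> dom \<Phi> \<subseteq> dom (map_of K) \<Longrightarrow> act_ok \<Sigma> \<Phi> {} \<Phi>' V' K FVar
    \<Longrightarrow> act_ok \<Sigma> \<Phi>' V' \<Phi>'' V'' I \<sigma>
    \<Longrightarrow> act I \<sigma> (inst K e) = inst (map_inst (act I \<sigma>) K) e"
proof (induction rule: valid_arg.induct)
  case (valid_Sym S c as d es)
  then show ?case by (auto simp: list_all2_conv_all_nth in_set_conv_nth)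
next
  case (valid_Meta M c ts d)
  then obtain e0 where e0: "map_of K M = Some e0" by blast
  have "valid_arg \<Sigma> \<Phi>' V' 0 (c, length ts) e0"
    using valid_Meta.prems(2) valid_Meta(1) e0 by (rule act_ok_Some)
  then have "valid_arg \<Sigma> \<Phi>' V' d (c, length (map (inst K) ts)) e0"
    by (auto intro: valid_mono)
  moreover have "\<forall>t \<in> set (map (inst K) ts). valid_tm \<Sigma> \<Phi>' V' d t"
    using valid_Meta by (auto simp: inst_eq_act intro: act_valid)
  ultimately have "act I \<sigma> (apply_arg e0 (map (inst K) ts)) =
      apply_arg (act I \<sigma> e0) (map (act I \<sigma>) (map (inst K) ts))"
    using valid_Meta.prems(3) act_apply_arg by blast
  moreover have "map (act I \<sigma> \<circ> inst K) ts = map (inst (map_inst (act I \<sigma>) K)) ts"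
    using valid_Meta by auto
  ultimately show ?case using e0 by simp
qed auto


section \<open>Judgements, boundaries and instantiations under an action\<close>

primrec on_judgement :: "('s expr \<Rightarrow> 's expr) \<Rightarrow> 's judgement \<Rightarrow> 's judgement" where
  "on_judgement f (JThesis j) = JThesis (map_jthesis f j)"
| "on_judgement f (JAbs A J) = JAbs (f A) (on_judgement f J)"

primrec on_boundary :: "('s expr \<Rightarrow> 's expr) \<Rightarrow> 's boundary \<Rightarrow> 's boundary" where
  "on_boundary f (BThesis b) = BThesis (map_bthesis f b)"
| "on_boundary f (BAbs A B) = BAbs (f A) (on_boundary f B)"

lemma inst_judgement_eq: "inst_judgement I = on_judgement (inst I)"
proof
  show "inst_judgement I J = on_judgement (inst I) J" for J by (induction J) auto
qed

lemma inst_boundary_eq: "inst_boundary I = on_boundary (inst I)"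
proof
  show "inst_boundary I B = on_boundary (inst I) B" for B by (induction B) auto
qed

lemma on_judgement_id: "(\<And>e. f e = e) \<Longrightarrow> on_judgement f J = J"
proof (induction J)
  case (JThesis j)
  then show ?case by (cases j) auto
qed auto

lemma class_map_bthesis [simp]: "class_bthesis (map_bthesis f b) = class_bthesis b"
  by (cases b) auto

lemma on_boundary_foldr_BAbs:
  "on_boundary f (foldr BAbs As B) = foldr BAbs (map f As) (on_boundary f B)"
  by (induction As) auto

lemma on_boundary_cong:
  "valid_boundary \<Sigma> \<Phi> V d B \<Longrightarrow> (\<And>d ar e. valid_arg \<Sigma> \<Phi> V d ar e \<Longrightarrow> f e = g e)
    \<Longrightarrow> on_boundary f B = on_boundary g B"
proof (induction B arbitrary: d)
  case (BThesis b)
  then show ?case by (cases b) auto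
qed auto

lemma map_bthesis_cong:
  "valid_bthesis \<Sigma> \<Phi> V d b \<Longrightarrow> (\<And>c e. valid_arg \<Sigma> \<Phi> V d (c, 0) e \<Longrightarrow> f e = g e)
    \<Longrightarrow> map_bthesis f b = map_bthesis g b"
  by (cases b) auto

lemma map_jthesis_cong:
  "valid_jthesis \<Sigma> \<Phi> V d j \<Longrightarrow> (\<And>c e. valid_arg \<Sigma> \<Phi> V d (c, 0) e \<Longrightarrow> f e = g e)
    \<Longrightarrow> map_jthesis f j = map_jthesis g j"
  by (cases j) auto

lemma valid_map_bthesis:
  "valid_bthesis \<Sigma> \<Phi> V d b \<Longrightarrow> (\<And>c e. valid_arg \<Sigma> \<Phi> V d (c, 0) e \<Longrightarrow> valid_arg \<Sigma> \<Phi>' V' d' (c, 0) (f e))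
    \<Longrightarrow> valid_bthesis \<Sigma> \<Phi>' V' d' (map_bthesis f b)"
  by (cases b) auto

lemma valid_map_jthesis:
  "valid_jthesis \<Sigma> \<Phi> V d j \<Longrightarrow> (\<And>c e. valid_arg \<Sigma> \<Phi> V d (c, 0) e \<Longrightarrow> valid_arg \<Sigma> \<Phi>' V' d' (c, 0) (f e))
    \<Longrightarrow> valid_jthesis \<Sigma> \<Phi>' V' d' (map_jthesis f j)"
  by (cases j) auto

lemma valid_on_judgement:
  "valid_judgement \<Sigma> \<Phi> V d J \<Longrightarrow>
     (\<And>d ar e. valid_arg \<Sigma> \<Phi> V d ar e \<Longrightarrow> valid_arg \<Sigma> \<Phi>' V' d ar (f e))
    \<Longrightarrow> valid_judgement \<Sigma> \<Phi>' V' d (on_judgement f J)"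
  by (induction J arbitrary: d) (auto intro: valid_map_jthesis)

lemma valid_on_boundary:
  "valid_boundary \<Sigma> \<Phi> V d B \<Longrightarrow>
     (\<And>d ar e. valid_arg \<Sigma> \<Phi> V d ar e \<Longrightarrow> valid_arg \<Sigma> \<Phi>' V' d ar (f e))
    \<Longrightarrow> valid_boundary \<Sigma> \<Phi>' V' d (on_boundary f B)"
  by (induction B arbitrary: d) (auto intro: valid_map_bthesis)

lemma on_boundary_act_inst:
  assumes "valid_boundary \<Sigma> \<Phi> {} d B" "dom \<Phi> \<subseteq> dom (map_of K)" "act_ok \<Sigma> \<Phi> {} \<Phi>' V' K FVar"
    "act_ok \<Sigma> \<Phi>' V' \<Phi>'' V'' I \<sigma>"
  shows "on_boundary (act I \<sigma>) (inst_boundary K B) = inst_boundary (map_inst (act I \<sigma>) K) B"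
  using assms(1)
proof (induction B arbitrary: d)
  case (BThesis b)
  then show ?case using act_inst[OF _ assms(2-4)] by (cases b) auto
qed (use act_inst[OF _ assms(2-4)] in auto)

lemma fill_on_boundary:
  "has_abs (abs_depth B) e \<Longrightarrow> f = act I \<sigma> \<Longrightarrow>
    on_judgement f (fill B e) = fill (on_boundary f B) (f e)"
proof (induction B arbitrary: e)
  case (BThesis b)
  then show ?case by (cases b) auto
qed auto

lemma act_bsubst_judgement:
  assumes "valid_judgement \<Sigma> \<Phi> V d J" "a \<notin> V" "act_ok \<Sigma> \<Phi> V \<Phi>' V' I \<sigma>" "valid_tm \<Sigma> \<Phi>' V' 0 t"
  shows "on_judgement (act I (\<sigma>(a := t))) (bsubst_judgement k (FVar a) J) =
    bsubst_judgement k t (on_judgement (act I \<sigma>) J)"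
proof -
  note * = act_bsubst_FVar[OF _ assms(2-4)]
  show ?thesis
    using assms(1)
  proof (induction J arbitrary: d k)
    case (JThesis j)
    then show ?case by (cases j) (auto simp: * simp del: fun_upd_apply)
  qed (auto simp: * valid_lift_id[OF assms(4)] simp del: fun_upd_apply)
qed

lemma act_bsubst_boundary:
  assumes "valid_boundary \<Sigma> \<Phi> V d B" "a \<notin> V" "act_ok \<Sigma> \<Phi> V \<Phi>' V' I \<sigma>" "valid_tm \<Sigma> \<Phi>' V' 0 t"
  shows "on_boundary (act I (\<sigma>(a := t))) (bsubst_boundary k (FVar a) B) =
    bsubst_boundary k t (on_boundary (act I \<sigma>) B)"
proof -
  note * = act_bsubst_FVar[OF _ assms(2-4)]
  show ?thesis
    using assms(1)
  proof (induction B arbitrary: d k)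
    case (BThesis b)
    then show ?case by (cases b) (auto simp: * simp del: fun_upd_apply)
  qed (auto simp: * valid_lift_id[OF assms(4)] simp del: fun_upd_apply)
qed


section \<open>Contexts and instantiations\<close>

lemma map_of_parallel:
  "map fst I = map fst \<Xi> \<Longrightarrow> map_of \<Xi> M = Some B
    \<Longrightarrow> \<exists>i < length \<Xi>. \<Xi> ! i = (M, B) \<and> map_of I M = Some (snd (I ! i))"
proof (induction \<Xi> arbitrary: I)
  case (Cons x \<Xi>)
  then obtain y I' where I: "I = y # I'" "fst y = fst x" "map fst I' = map fst \<Xi>" by auto
  show ?case
  proof (cases "fst x = M")
    case True
    then show ?thesis using Cons.prems I by (cases x; cases y) auto
  next
    case False
    then have "map_of \<Xi> M = Some B" using Cons.prems by (cases x) auto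
    with Cons.IH[OF I(3)] obtain i
      where "i < length \<Xi>" "\<Xi> ! i = (M, B)" "map_of I' M = Some (snd (I' ! i))" by auto
    then show ?thesis using False I by (cases y) (auto intro!: exI[of _ "Suc i"])
  qed
qed simp

lemma mv_arity_take: "mv_arity (take i \<Xi>) \<subseteq>\<^sub>m mv_arity \<Xi>"
proof -
  have "map_of (take i \<Xi>) \<subseteq>\<^sub>m map_of (take i \<Xi> @ drop i \<Xi>)"
    by (auto simp: map_le_def map_add_def dom_def simp del: append_take_drop_id split: option.split)
  then show ?thesis
    by (auto simp: map_le_def mv_arity_def dom_def)
qed

lemma valid_boundary_mono:
  "valid_boundary \<Sigma> \<Phi> V d B \<Longrightarrow> V \<subseteq> V' \<Longrightarrow> \<Phi> \<subseteq>\<^sub>m \<Phi>' \<Longrightarrow> valid_boundary \<Sigma> \<Phi>' V' d B"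
proof (induction B arbitrary: d)
  case (BThesis b)
  then show ?case by (cases b) (auto elim: valid_mono)
qed (auto elim: valid_mono)

lemma mctx_nth_valid:
  "is_mctx \<Sigma> \<Xi> \<Longrightarrow> i < length \<Xi> \<Longrightarrow> valid_boundary \<Sigma> (mv_arity (take i \<Xi>)) {} 0 (snd (\<Xi> ! i))"
  by (simp add: is_mctx_def)

lemma mctx_lookup_valid:
  assumes "is_mctx \<Sigma> \<Xi>" "map_of \<Xi> M = Some B"
  shows "valid_boundary \<Sigma> (mv_arity \<Xi>) {} 0 B"
proof -
  obtain i where "i < length \<Xi>" "\<Xi> ! i = (M, B)"
    using map_of_parallel[OF refl assms(2)] by blast
  then show ?thesis
    using mctx_nth_valid[OF assms(1), of i] mv_arity_take[of i \<Xi>]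
    by (auto elim: valid_boundary_mono)
qed

lemma mctx_telescope_valid:
  assumes "is_mctx \<Sigma> \<Xi>" "map_of \<Xi> M = Some (foldr BAbs As (BThesis b))"
  shows "j < length As \<Longrightarrow> valid_ty \<Sigma> (mv_arity \<Xi>) {} j (As ! j)"
    and "valid_bthesis \<Sigma> (mv_arity \<Xi>) {} (length As) b"
  using mctx_lookup_valid[OF assms] by (auto simp: valid_boundary_foldr_BAbs)

lemma is_inst_take: "is_inst \<Sigma> \<Theta> \<Gamma> \<Xi> I \<Longrightarrow> is_inst \<Sigma> \<Theta> \<Gamma> (take i \<Xi>) (take i I)"
  by (auto simp: is_inst_def take_map[symmetric])

lemma is_inst_dom: "is_inst \<Sigma> \<Theta> \<Gamma> \<Xi> I \<Longrightarrow> dom (mv_arity \<Xi>) \<subseteq> dom (map_of I)"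
  using map_of_parallel[of I \<Xi>] by (fastforce simp: is_inst_def mv_arity_def)

text \<open>\<open>I\<close> binds every metavariable of \<open>\<Xi>\<close>, so no name is left in
  place, and \<open>\<sigma>\<close> is arbitrary because no free variable is in scope.\<close>

lemma is_inst_act_ok:
  assumes "is_inst \<Sigma> \<Theta> \<Gamma> \<Xi> I"
  shows "act_ok \<Sigma> (mv_arity \<Xi>) {} (mv_arity \<Theta>) (dom_ctx \<Gamma>) I \<sigma>"
proof -
  have "\<exists>e. map_of I M = Some e \<and> valid_arg \<Sigma> (mv_arity \<Theta>) (dom_ctx \<Gamma>) 0 ar e"
    if M: "mv_arity \<Xi> M = Some ar" for M ar
  proof -
    obtain B where B: "map_of \<Xi> M = Some B" "ar = arity_boundary B"
      using M by (auto simp: mv_arity_def)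
    with map_of_parallel[of I \<Xi> M B] assms show ?thesis
      by (force simp: is_inst_def)
  qed
  then show ?thesis by (fastforce simp: act_ok_def)
qed

lemma is_inst_length: "is_inst \<Sigma> \<Theta> \<Gamma> \<Xi> I \<Longrightarrow> length I = length \<Xi>"
  by (metis is_inst_def length_map)

lemma is_inst_map_inst:
  assumes "is_inst \<Sigma> \<Psi> \<Gamma> \<Xi> K" "act_ok \<Sigma> (mv_arity \<Psi>) (dom_ctx \<Gamma>) (mv_arity \<Theta>) (dom_ctx \<Gamma>') I \<sigma>"
  shows "is_inst \<Sigma> \<Theta> \<Gamma>' \<Xi> (map_inst (act I \<sigma>) K)"
  using assms(1) is_inst_length[OF assms(1)]
  by (auto simp: is_inst_def snd_nth_map_inst intro: act_valid[OF _ assms(2)])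

lemma is_inst_has_abs:
  "is_inst \<Sigma> \<Psi> \<Gamma> \<Xi> K \<Longrightarrow> i < length \<Xi> \<Longrightarrow> has_abs (abs_depth (snd (\<Xi> ! i))) (snd (K ! i))"
  by (auto simp: is_inst_def arity_boundary_def intro: valid_has_abs)

lemma abs_depth_on_boundary [simp]: "abs_depth (on_boundary f B) = abs_depth B"
  by (induction B) auto

text \<open>The boundary at position \<open>i\<close> mentions only metavariables before
  \<open>i\<close>, all of them bound by \<open>take i K\<close>. So \<open>act_inst\<close> applies
  with this prefix as the whole instantiation.\<close>

lemma act_inst_boundary_take:
  assumes "is_mctx \<Sigma> \<Xi>" "is_inst \<Sigma> \<Psi> \<Gamma> \<Xi> K" "act_ok \<Sigma> (mv_arity \<Psi>) (dom_ctx \<Gamma>) \<Phi> V I \<sigma>"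
    "i < length \<Xi>"
  shows "on_boundary (act I \<sigma>) (inst_boundary (take i K) (snd (\<Xi> ! i))) =
    inst_boundary (take i (map_inst (act I \<sigma>) K)) (snd (\<Xi> ! i))"
  unfolding take_map_inst
  using mctx_nth_valid[OF assms(1,4)] is_inst_dom[OF is_inst_take[OF assms(2)]]
    is_inst_act_ok[OF is_inst_take[OF assms(2)]] assms(3)
  by (rule on_boundary_act_inst)

lemma act_inst_premise:
  assumes "is_mctx \<Sigma> \<Xi>" "is_inst \<Sigma> \<Psi> \<Gamma> \<Xi> K" "act_ok \<Sigma> (mv_arity \<Psi>) (dom_ctx \<Gamma>) \<Phi> V I \<sigma>"
    "i < length \<Xi>"
  shows "on_judgement (act I \<sigma>) (inst_premise K \<Xi> i) = inst_premise (map_inst (act I \<sigma>) K) \<Xi> i"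
  using assms(4) act_inst_boundary_take[OF assms] is_inst_has_abs[OF assms(2,4)]
    is_inst_length[OF assms(2)]
  by (simp add: inst_premise_def fill_on_boundary inst_boundary_eq snd_nth_map_inst)

lemma object_boundary_simps [simp]:
  "object_boundary (BThesis b) \<longleftrightarrow> class_bthesis b \<in> {Ty, Tm}"
  "object_boundary (BAbs A B) \<longleftrightarrow> object_boundary B"
  by (simp_all add: object_boundary_def)

lemma object_on_boundary [simp]: "object_boundary (on_boundary f B) \<longleftrightarrow> object_boundary B"
  by (induction B) auto

lemma fill_eq_on_boundary:
  "object_boundary B \<Longrightarrow> has_abs (abs_depth B) e \<Longrightarrow> has_abs (abs_depth B) e' \<Longrightarrow> f = act I \<sigma> \<Longrightarrow>
    on_judgement f (fill_eq B e e') = fill_eq (on_boundary f B) (f e) (f e')"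
proof (induction B arbitrary: e e')
  case (BThesis b)
  then show ?case by (cases b) auto
qed auto

lemma act_inst_eq_premise:
  assumes "is_mctx \<Sigma> \<Xi>" "is_inst \<Sigma> \<Psi> \<Gamma> \<Xi> K" "is_inst \<Sigma> \<Psi> \<Gamma> \<Xi> L"
    "act_ok \<Sigma> (mv_arity \<Psi>) (dom_ctx \<Gamma>) \<Phi> V I \<sigma>" "i < length \<Xi>" "object_boundary (snd (\<Xi> ! i))"
  shows "on_judgement (act I \<sigma>) (inst_eq_premise K L \<Xi> i) =
    inst_eq_premise (map_inst (act I \<sigma>) K) (map_inst (act I \<sigma>) L) \<Xi> i"
  using assms(5,6) act_inst_boundary_take[OF assms(1,2,4,5)]
    is_inst_has_abs[OF assms(2,5)] is_inst_has_abs[OF assms(3,5)]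
    is_inst_length[OF assms(2)] is_inst_length[OF assms(3)]
  by (simp add: inst_eq_premise_def fill_eq_on_boundary inst_boundary_eq snd_nth_map_inst)

lemma act_inst_jthesis:
  assumes "valid_jthesis \<Sigma> (mv_arity \<Xi>) {} 0 j" "is_inst \<Sigma> \<Psi> \<Gamma> \<Xi> K"
    "act_ok \<Sigma> (mv_arity \<Psi>) (dom_ctx \<Gamma>) \<Phi> V I \<sigma>"
  shows "map_jthesis (act I \<sigma>) (inst_jthesis K j) = inst_jthesis (map_inst (act I \<sigma>) K) j"
  using assms(1) act_inst[OF _ is_inst_dom[OF assms(2)] is_inst_act_ok[OF assms(2)] assms(3)]
  by (cases j) auto

lemma map_bthesis_boundary_of: "map_bthesis f (boundary_of j) = boundary_of (map_jthesis f j)"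
  by (cases j) auto

text \<open>Types and theses in a metavariable context have no free variables, so only the
  instantiation part of the action reaches them, while \<open>\<sigma>\<close> acts on the
  arguments. This is why metavariable rules can be treated independently of
  \<open>\<sigma>\<close>.\<close>

lemma act_bsubsts_closed:
  assumes "valid_arg \<Sigma> \<Phi> {} (length ts) (c, 0) e" "act_ok \<Sigma> \<Phi> V \<Phi>' V' I \<sigma>"
    "\<forall>t \<in> set ts. valid_tm \<Sigma> \<Phi> V 0 t"
  shows "act I \<sigma> (bsubsts ts e) = bsubsts (map (act I \<sigma>) ts) (inst I e)"
proof -
  have "valid_arg \<Sigma> \<Phi> V (length ts) (c, 0) e" using assms(1) by (auto elim: valid_mono)
  moreover have "act I \<sigma> e = inst I e"
    unfolding inst_eq_act using assms(1) by (rule act_cong) auto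
  ultimately show ?thesis using act_bsubsts[OF _ assms(2,3)] by metis
qed

text \<open>Unlike \<open>is_vctx\<close>, this does not require types to mention earlier variables only.\<close>

definition good_ctx :: "'s signature \<Rightarrow> 's mctx \<Rightarrow> 's vctx \<Rightarrow> bool" where
  "good_ctx \<Sigma> \<Theta> \<Gamma> \<longleftrightarrow> (\<forall>a A. map_of \<Gamma> a = Some A \<longrightarrow> valid_ty \<Sigma> (mv_arity \<Theta>) (dom_ctx \<Gamma>) 0 A)"

lemma good_ctx_snoc:
  "good_ctx \<Sigma> \<Theta> \<Gamma> \<Longrightarrow> valid_ty \<Sigma> (mv_arity \<Theta>) (dom_ctx \<Gamma>) 0 A \<Longrightarrow> good_ctx \<Sigma> \<Theta> (\<Gamma> @ [(a, A)])"
  unfolding good_ctx_def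
  by (auto simp: map_add_Some_iff split: if_splits intro: valid_mono[OF _ subset_insertI le_refl map_le_refl])

lemma map_of_snoc:
  "map_of (\<Gamma> @ [(a, A)]) = (\<lambda>b. case map_of \<Gamma> b of None \<Rightarrow> if b = a then Some A else None | Some B \<Rightarrow> Some B)"
  by (auto simp: map_add_def split: option.split)

lemma map_of_snoc_fresh: "a \<notin> dom_ctx \<Gamma> \<Longrightarrow> map_of (\<Gamma> @ [(a, A)]) a = Some A"
  unfolding map_of_snoc by (force split: option.split dest: map_of_SomeD)

lemma is_vctx_good_ctx: "is_vctx \<Sigma> \<Theta> \<Gamma> \<Longrightarrow> good_ctx \<Sigma> \<Theta> \<Gamma>"
  unfolding good_ctx_def
proof (intro allI impI)
  fix a A assume \<Gamma>: "is_vctx \<Sigma> \<Theta> \<Gamma>" and "map_of \<Gamma> a = Some A"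
  then obtain i where i: "i < length \<Gamma>" "\<Gamma> ! i = (a, A)"
    by (metis in_set_conv_nth map_of_SomeD)
  then have "valid_ty \<Sigma> (mv_arity \<Theta>) (dom_ctx (take i \<Gamma>)) 0 A"
    using \<Gamma> by (auto simp: is_vctx_def)
  then show "valid_ty \<Sigma> (mv_arity \<Theta>) (dom_ctx \<Gamma>) 0 A"
    using set_take_subset[of i \<Gamma>] by (auto elim!: valid_mono)
qed

section \<open>Scoping of derivable judgements\<close>

locale raw_tt =
  fixes \<Sigma> :: "'s signature" and T :: "'s raw_rule set"
  assumes raw_type_theory: "raw_type_theory \<Sigma> T"
begin

lemma rule_valid:
  assumes "(\<Xi>, j) \<in> T"
  shows "is_mctx \<Sigma> \<Xi>" "valid_jthesis \<Sigma> (mv_arity \<Xi>) {} 0 j"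
  using assms raw_type_theory by (auto simp: raw_type_theory_def is_raw_rule_def)

text \<open>The rules do not themselves demand a well-scoped context. The condition
  \<open>good_ctx\<close> is kept as an implication inside the induction, since abstraction enlarges
  the context: validity of \<open>A\<close> makes the larger context good before the body is
  considered.\<close>

lemma deriv_valid:
  assumes \<Theta>: "is_mctx \<Sigma> \<Theta>"
  shows "deriv \<Sigma> T \<Theta> \<Gamma> J \<Longrightarrow> good_ctx \<Sigma> \<Theta> \<Gamma> \<longrightarrow> valid_judgement \<Sigma> (mv_arity \<Theta>) (dom_ctx \<Gamma>) 0 J"
    and "deriv_bdry \<Sigma> T \<Theta> \<Delta> B \<Longrightarrow> good_ctx \<Sigma> \<Theta> \<Delta> \<longrightarrow> valid_boundary \<Sigma> (mv_arity \<Theta>) (dom_ctx \<Delta>) 0 B"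
proof (induct rule: deriv_deriv_bdry.inducts)
  case (tt_var \<Gamma> a A)
  then have "a \<in> dom_ctx \<Gamma>" by (force dest: map_of_SomeD)
  then show ?case using tt_var by (auto simp: good_ctx_def intro: valid_FVar)
next
  case (tt_meta M As b ts \<Gamma>)
  have M: "mv_arity \<Theta> M = Some (class_bthesis b, length ts)"
    using tt_meta by (simp add: mv_arity_def)
  have "valid_tm \<Sigma> (mv_arity \<Theta>) (dom_ctx \<Gamma>) 0 t" if "good_ctx \<Sigma> \<Theta> \<Gamma>" "t \<in> set ts" for t
    using tt_meta(2,3) that by (auto simp: in_set_conv_nth)
  then show ?case
    using M tt_meta(5) by (cases b) (auto intro!: valid_Meta)
next
  case (tt_meta_congr M As b ss ts \<Gamma>)
  have M: "mv_arity \<Theta> M = Some (class_bthesis b, length ss)" "length ts = length ss"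
    using tt_meta_congr by (simp_all add: mv_arity_def)
  have "valid_tm \<Sigma> (mv_arity \<Theta>) (dom_ctx \<Gamma>) 0 t" if "good_ctx \<Sigma> \<Theta> \<Gamma>" "t \<in> set ts" for t
    using tt_meta_congr(4,6) that by (auto simp: in_set_conv_nth)
  moreover have "valid_tm \<Sigma> (mv_arity \<Theta>) (dom_ctx \<Gamma>) 0 t" if "good_ctx \<Sigma> \<Theta> \<Gamma>" "t \<in> set ss" for t
    using tt_meta_congr(3,5) that by (auto simp: in_set_conv_nth)
  \<comment> \<open>For a term boundary the conclusion also carries the type at \<open>ss\<close>;
    its validity comes from the type equation among the premises.\<close>
  ultimately show ?case
    using M tt_meta_congr(2,8) by (cases b) (auto intro!: valid_Meta)
next
  case (tt_abstr \<Gamma> A a J)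
  then show ?case
    using good_ctx_snoc[of \<Sigma> \<Theta> \<Gamma> A a]
    by (auto intro: valid_judgement_bsubst_FVar_cancel)
next
  case (tt_rule \<Xi> j \<Gamma> I)
  then show ?case
    using rule_valid[OF tt_rule(1)] act_valid[OF _ is_inst_act_ok[OF tt_rule(2)]]
    by (auto simp: inst_eq_act intro: valid_map_jthesis)
next
  case (tt_congr_ty \<Xi> A \<Gamma> I K)
  then show ?case
    using rule_valid[OF tt_congr_ty(1)] act_valid[OF _ is_inst_act_ok[OF tt_congr_ty(2)]]
      act_valid[OF _ is_inst_act_ok[OF tt_congr_ty(3)]]
    by (auto simp: inst_eq_act)
next
  case (tt_congr_tm \<Xi> t A \<Gamma> I K)
  then show ?case
    using rule_valid[OF tt_congr_tm(1)] act_valid[OF _ is_inst_act_ok[OF tt_congr_tm(2)]]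
      act_valid[OF _ is_inst_act_ok[OF tt_congr_tm(3)]]
    by (auto simp: inst_eq_act)
next
  case (bdry_abstr \<Gamma> A a B)
  then show ?case
    using good_ctx_snoc[of \<Sigma> \<Theta> \<Gamma> A a]
    by (auto intro: valid_boundary_bsubst_FVar_cancel)
qed auto

lemma deriv_term_valid:
  "is_mctx \<Sigma> \<Theta> \<Longrightarrow> good_ctx \<Sigma> \<Theta> \<Gamma> \<Longrightarrow> deriv \<Sigma> T \<Theta> \<Gamma> (JThesis (IsTerm t A))
    \<Longrightarrow> valid_tm \<Sigma> (mv_arity \<Theta>) (dom_ctx \<Gamma>) 0 t"
  by (auto dest: deriv_valid(1))

lemma deriv_type_valid:
  "is_mctx \<Sigma> \<Theta> \<Longrightarrow> good_ctx \<Sigma> \<Theta> \<Gamma> \<Longrightarrow> deriv \<Sigma> T \<Theta> \<Gamma> (JThesis (IsType A))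
    \<Longrightarrow> valid_ty \<Sigma> (mv_arity \<Theta>) (dom_ctx \<Gamma>) 0 A"
  by (auto dest: deriv_valid(1))

end


section \<open>Derivability under an action\<close>

text \<open>The result of an action on a metavariable application once the arguments have been acted
  upon. It depends on \<open>I\<close> alone, which separates the treatment of metavariables from
  that of variables.\<close>

definition meta_head :: "'s inst_map \<Rightarrow> mvar \<Rightarrow> 's expr list \<Rightarrow> 's expr" where
  "meta_head I M ts = (case map_of I M of Some e \<Rightarrow> apply_arg e ts | None \<Rightarrow> Meta M ts)"

lemma act_Meta: "act I \<sigma> (Meta M ts) = meta_head I M (map (act I \<sigma>) ts)"
  by (simp add: meta_head_def)

lemma fresh_dom_ctx: "\<exists>a. a \<notin> dom_ctx (\<Gamma> :: 's vctx)"
  by (rule ex_new_if_finite) auto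

lemma map_fill_thesis: "map_jthesis f (fill_thesis b e) = fill_thesis (map_bthesis f b) (f e)"
  by (cases b) auto

lemma (in raw_tt) deriv_terms_valid:
  assumes "is_mctx \<Sigma> \<Theta>" "good_ctx \<Sigma> \<Theta> \<Gamma>" "length ts = n"
    "\<And>j. j < n \<Longrightarrow> deriv \<Sigma> T \<Theta> \<Gamma> (JThesis (IsTerm (ts ! j) (F j)))"
  shows "\<forall>t \<in> set ts. valid_tm \<Sigma> (mv_arity \<Theta>) (dom_ctx \<Gamma>) 0 t"
  using assms deriv_term_valid[OF assms(1,2)] by (metis in_set_conv_nth)

text \<open>\<open>Q\<close> is an invariant of target contexts, and \<open>R \<Gamma> t A\<close> says which terms may be substituted for a
  variable of type \<open>A\<close>. Taking only variables for \<open>R\<close> is what yields weakening, which is in turn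
  needed for \<open>R_snoc\<close> when \<open>R\<close> is derivability.\<close>

locale derivation_action = raw_tt \<Sigma> T
  for \<Sigma> :: "'s signature" and T :: "'s raw_rule set" +
  fixes \<Theta> \<Xi> :: "'s mctx" and I :: "'s inst_map"
    and Q :: "'s vctx \<Rightarrow> bool" and R :: "'s vctx \<Rightarrow> 's expr \<Rightarrow> 's expr \<Rightarrow> bool"
  assumes mctx: "is_mctx \<Sigma> \<Theta>" "is_mctx \<Sigma> \<Xi>"
    and Q_good: "Q \<Gamma> \<Longrightarrow> good_ctx \<Sigma> \<Theta> \<Gamma>"
    and Q_ok: "Q \<Gamma> \<Longrightarrow> act_ok \<Sigma> (mv_arity \<Xi>) {} (mv_arity \<Theta>) (dom_ctx \<Gamma>) I FVar"
    and Q_snoc: "Q \<Gamma> \<Longrightarrow> a \<notin> dom_ctx \<Gamma> \<Longrightarrow> valid_ty \<Sigma> (mv_arity \<Theta>) (dom_ctx \<Gamma>) 0 A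
      \<Longrightarrow> Q (\<Gamma> @ [(a, A)])"
    and R_deriv: "Q \<Gamma> \<Longrightarrow> R \<Gamma> t A \<Longrightarrow> deriv \<Sigma> T \<Theta> \<Gamma> (JThesis (IsTerm t A))"
    and R_snoc: "Q \<Gamma> \<Longrightarrow> a \<notin> dom_ctx \<Gamma> \<Longrightarrow> valid_ty \<Sigma> (mv_arity \<Theta>) (dom_ctx \<Gamma>) 0 A
      \<Longrightarrow> R \<Gamma> t B \<Longrightarrow> R (\<Gamma> @ [(a, A)]) t B"
    and R_var: "Q \<Gamma> \<Longrightarrow> a \<notin> dom_ctx \<Gamma> \<Longrightarrow> valid_ty \<Sigma> (mv_arity \<Theta>) (dom_ctx \<Gamma>) 0 A
      \<Longrightarrow> R (\<Gamma> @ [(a, A)]) (FVar a) A"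
    and meta: "Q \<Gamma> \<Longrightarrow> map_of \<Xi> M = Some (foldr BAbs As (BThesis b)) \<Longrightarrow> length ts = length As
      \<Longrightarrow> (\<forall>j < length As.
            deriv \<Sigma> T \<Theta> \<Gamma> (JThesis (IsTerm (ts ! j) (bsubsts (take j ts) (inst I (As ! j))))))
      \<Longrightarrow> deriv_bdry \<Sigma> T \<Theta> \<Gamma> (BThesis (map_bthesis (bsubsts ts) (inst_bthesis I b)))
      \<Longrightarrow> deriv \<Sigma> T \<Theta> \<Gamma>
            (JThesis (fill_thesis (map_bthesis (bsubsts ts) (inst_bthesis I b)) (meta_head I M ts)))"
    and meta_congr: "Q \<Gamma> \<Longrightarrow> map_of \<Xi> M = Some (foldr BAbs As (BThesis b))
      \<Longrightarrow> class_bthesis b \<in> {Ty, Tm} \<Longrightarrow> length ss = length As \<Longrightarrow> length ts = length As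
      \<Longrightarrow> (\<forall>j < length As.
            deriv \<Sigma> T \<Theta> \<Gamma> (JThesis (IsTerm (ss ! j) (bsubsts (take j ss) (inst I (As ! j))))))
      \<Longrightarrow> (\<forall>j < length As.
            deriv \<Sigma> T \<Theta> \<Gamma> (JThesis (IsTerm (ts ! j) (bsubsts (take j ts) (inst I (As ! j))))))
      \<Longrightarrow> (\<forall>j < length As.
            deriv \<Sigma> T \<Theta> \<Gamma>
              (JThesis (EqTerm (ss ! j) (ts ! j) (bsubsts (take j ss) (inst I (As ! j))))))
      \<Longrightarrow> (\<forall>C. b = BdTerm C \<longrightarrow>
            deriv \<Sigma> T \<Theta> \<Gamma> (JThesis (EqType (bsubsts ss (inst I C)) (bsubsts ts (inst I C)))))
      \<Longrightarrow> deriv \<Sigma> T \<Theta> \<Gamma>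
            (fill_eq (BThesis (map_bthesis (bsubsts ss) (inst_bthesis I b)))
              (meta_head I M ss) (meta_head I M ts))"
begin

definition typed :: "'s vctx \<Rightarrow> 's vctx \<Rightarrow> (fvar \<Rightarrow> 's expr) \<Rightarrow> bool" where
  "typed \<Gamma> \<Gamma>' \<sigma> \<longleftrightarrow> (\<forall>a A. map_of \<Gamma> a = Some A \<longrightarrow> R \<Gamma>' (\<sigma> a) (act I \<sigma> A))"

lemma typed_ok:
  assumes "Q \<Gamma>'" "typed \<Gamma> \<Gamma>' \<sigma>"
  shows "act_ok \<Sigma> (mv_arity \<Xi>) (dom_ctx \<Gamma>) (mv_arity \<Theta>) (dom_ctx \<Gamma>') I \<sigma>"
proof -
  have "valid_tm \<Sigma> (mv_arity \<Theta>) (dom_ctx \<Gamma>') 0 (\<sigma> a)" if "a \<in> dom_ctx \<Gamma>" for a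
  proof -
    have "map_of \<Gamma> a \<noteq> None" using that by (simp add: map_of_eq_None_iff)
    then obtain A where "map_of \<Gamma> a = Some A" by blast
    then have "R \<Gamma>' (\<sigma> a) (act I \<sigma> A)" using assms(2) by (simp add: typed_def)
    then show ?thesis
      using deriv_term_valid[OF mctx(1) Q_good[OF assms(1)] R_deriv[OF assms(1)]] by simp
  qed
  then show ?thesis using Q_ok[OF assms(1)] by (simp add: act_ok_def)
qed

text \<open>The name \<open>a\<close> is fixed by the given derivation and may already occur in
  \<open>\<Gamma>'\<close>, so a fresh \<open>a'\<close> takes its place there. The types in
  \<open>\<Gamma>\<close> and \<open>A\<close> itself do not mention \<open>a\<close>, hence the
  update does not change their images.\<close>

lemma typed_snoc:
  assumes "good_ctx \<Sigma> \<Xi> \<Gamma>" "Q \<Gamma>'" "typed \<Gamma> \<Gamma>' \<sigma>" "a \<notin> dom_ctx \<Gamma>" "a' \<notin> dom_ctx \<Gamma>'"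
    "valid_ty \<Sigma> (mv_arity \<Xi>) (dom_ctx \<Gamma>) 0 A"
  shows "typed (\<Gamma> @ [(a, A)]) (\<Gamma>' @ [(a', act I \<sigma> A)]) (\<sigma>(a := FVar a'))"
  unfolding typed_def
proof (intro allI impI)
  fix b B assume b: "map_of (\<Gamma> @ [(a, A)]) b = Some B"
  have A': "valid_ty \<Sigma> (mv_arity \<Theta>) (dom_ctx \<Gamma>') 0 (act I \<sigma> A)"
    using assms(6) typed_ok[OF assms(2,3)] by (rule act_valid)
  have B: "valid_ty \<Sigma> (mv_arity \<Xi>) (dom_ctx \<Gamma>) 0 B"
    using b assms(1,6) by (auto simp: map_of_snoc good_ctx_def split: option.splits if_splits)
  have act_B: "act I (\<sigma>(a := FVar a')) B = act I \<sigma> B"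
    using B by (rule act_cong) (use assms(4) in auto)
  show "R (\<Gamma>' @ [(a', act I \<sigma> A)]) ((\<sigma>(a := FVar a')) b) (act I (\<sigma>(a := FVar a')) B)"
  proof (cases "map_of \<Gamma> b")
    case None
    then have "b = a" "B = A" using b by (auto simp: map_of_snoc split: if_splits)
    then show ?thesis using act_B R_var[OF assms(2,5) A'] by simp
  next
    case (Some C)
    then have "b \<noteq> a" "C = B" using b assms(4) by (force simp: map_of_snoc dest: map_of_SomeD)+
    then show ?thesis
      using Some act_B assms(3) R_snoc[OF assms(2,5) A'] by (simp add: typed_def)
  qed
qed

text \<open>\<open>\<Gamma>'\<close> and \<open>\<sigma>\<close> are quantified inside the induction
  statement because the abstraction rules extend the context and rename the chosen variable.
  Structural rules commute with the action clause by clause, and instances of specific rules are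
  carried to instances by \<open>act_inst\<close>.\<close>

theorem deriv_act:
  shows "deriv \<Sigma> T \<Xi> \<Gamma> J \<Longrightarrow> \<forall>\<Gamma>' \<sigma>. good_ctx \<Sigma> \<Xi> \<Gamma> \<longrightarrow> Q \<Gamma>' \<longrightarrow> typed \<Gamma> \<Gamma>' \<sigma>
      \<longrightarrow> deriv \<Sigma> T \<Theta> \<Gamma>' (on_judgement (act I \<sigma>) J)"
    and "deriv_bdry \<Sigma> T \<Xi> \<Delta> B \<Longrightarrow> \<forall>\<Gamma>' \<sigma>. good_ctx \<Sigma> \<Xi> \<Delta> \<longrightarrow> Q \<Gamma>' \<longrightarrow> typed \<Delta> \<Gamma>' \<sigma>
      \<longrightarrow> deriv_bdry \<Sigma> T \<Theta> \<Gamma>' (on_boundary (act I \<sigma>) B)"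
proof (induct rule: deriv_deriv_bdry.inducts)
  case (tt_var \<Gamma> a A)
  then show ?case using R_deriv by (auto simp: typed_def)
next
  case (tt_meta M As b ts \<Gamma>)
  show ?case
  proof (intro allI impI)
    fix \<Gamma>' \<sigma> assume prems: "good_ctx \<Sigma> \<Xi> \<Gamma>" "Q \<Gamma>'" "typed \<Gamma> \<Gamma>' \<sigma>"
    note ok = typed_ok[OF prems(2,3)]
    have ts: "\<forall>t \<in> set ts. valid_tm \<Sigma> (mv_arity \<Xi>) (dom_ctx \<Gamma>) 0 t"
      using tt_meta(3) by (intro deriv_terms_valid[OF mctx(2) prems(1) tt_meta(2)]) blast
    have b: "map_bthesis (act I \<sigma>) (map_bthesis (bsubsts ts) b) =
        map_bthesis (bsubsts (map (act I \<sigma>) ts)) (inst_bthesis I b)"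
      using mctx_telescope_valid(2)[OF mctx(2) tt_meta(1)] tt_meta(2)
      by (auto simp: bthesis.map_comp intro!: map_bthesis_cong act_bsubsts_closed[OF _ ok ts])
    have As: "act I \<sigma> (bsubsts (take j ts) (As ! j)) =
        bsubsts (take j (map (act I \<sigma>) ts)) (inst I (As ! j))" if "j < length As" for j
      using act_bsubsts_closed[OF _ ok, of "take j ts" Ty "As ! j"] ts that tt_meta(2)
        mctx_telescope_valid(1)[OF mctx(2) tt_meta(1) that]
      by (auto simp: take_map dest: in_set_takeD)
    have "deriv \<Sigma> T \<Theta> \<Gamma>' (JThesis (fill_thesis
        (map_bthesis (bsubsts (map (act I \<sigma>) ts)) (inst_bthesis I b))
        (meta_head I M (map (act I \<sigma>) ts))))"
      using prems(2) tt_meta(1)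
    proof (rule meta)
      show "\<forall>j<length As. deriv \<Sigma> T \<Theta> \<Gamma>' (JThesis (IsTerm (map (act I \<sigma>) ts ! j)
          (bsubsts (take j (map (act I \<sigma>) ts)) (inst I (As ! j)))))"
        using tt_meta(2,3) prems by (simp add: As[symmetric])
      show "deriv_bdry \<Sigma> T \<Theta> \<Gamma>'
          (BThesis (map_bthesis (bsubsts (map (act I \<sigma>) ts)) (inst_bthesis I b)))"
        using tt_meta(5) prems b by (metis on_boundary.simps(1))
    qed (use tt_meta(2) in simp)
    then show "deriv \<Sigma> T \<Theta> \<Gamma>' (on_judgement (act I \<sigma>)
        (JThesis (fill_thesis (map_bthesis (bsubsts ts) b) (Meta M ts))))"
      by (simp add: map_fill_thesis b act_Meta del: act.simps)
  qed
next
  case (tt_meta_congr M As b ss ts \<Gamma>)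
  show ?case
  proof (intro allI impI)
    fix \<Gamma>' \<sigma> assume prems: "good_ctx \<Sigma> \<Xi> \<Gamma>" "Q \<Gamma>'" "typed \<Gamma> \<Gamma>' \<sigma>"
    note ok = typed_ok[OF prems(2,3)]
    have ss: "\<forall>t \<in> set ss. valid_tm \<Sigma> (mv_arity \<Xi>) (dom_ctx \<Gamma>) 0 t"
      using tt_meta_congr(5) by (intro deriv_terms_valid[OF mctx(2) prems(1) tt_meta_congr(3)]) blast
    have ts: "\<forall>t \<in> set ts. valid_tm \<Sigma> (mv_arity \<Xi>) (dom_ctx \<Gamma>) 0 t"
      using tt_meta_congr(6) by (intro deriv_terms_valid[OF mctx(2) prems(1) tt_meta_congr(4)]) blast
    note b = mctx_telescope_valid(2)[OF mctx(2) tt_meta_congr(1)]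
    have C: "act I \<sigma> (bsubsts us C) = bsubsts (map (act I \<sigma>) us) (inst I C)"
      if "b = BdTerm C" "length us = length As" "\<forall>t \<in> set us. valid_tm \<Sigma> (mv_arity \<Xi>) (dom_ctx \<Gamma>) 0 t"
      for us C
      using act_bsubsts_closed[OF _ ok that(3)] b that by auto
    have As: "act I \<sigma> (bsubsts (take j us) (As ! j)) =
        bsubsts (take j (map (act I \<sigma>) us)) (inst I (As ! j))"
      if "j < length As" "length us = length As"
        "\<forall>t \<in> set us. valid_tm \<Sigma> (mv_arity \<Xi>) (dom_ctx \<Gamma>) 0 t" for j us
      using act_bsubsts_closed[OF _ ok, of "take j us" Ty "As ! j"] that
        mctx_telescope_valid(1)[OF mctx(2) tt_meta_congr(1) that(1)]
      by (auto simp: take_map dest: in_set_takeD)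
    have "deriv \<Sigma> T \<Theta> \<Gamma>'
        (fill_eq (BThesis (map_bthesis (bsubsts (map (act I \<sigma>) ss)) (inst_bthesis I b)))
          (meta_head I M (map (act I \<sigma>) ss)) (meta_head I M (map (act I \<sigma>) ts)))"
      using prems(2) tt_meta_congr(1,2)
    proof (rule meta_congr)
      show "\<forall>j<length As. deriv \<Sigma> T \<Theta> \<Gamma>' (JThesis (IsTerm (map (act I \<sigma>) ss ! j)
          (bsubsts (take j (map (act I \<sigma>) ss)) (inst I (As ! j)))))"
        using tt_meta_congr(3,5) prems by (simp add: As[OF _ _ ss, symmetric])
      show "\<forall>j<length As. deriv \<Sigma> T \<Theta> \<Gamma>' (JThesis (IsTerm (map (act I \<sigma>) ts ! j)
          (bsubsts (take j (map (act I \<sigma>) ts)) (inst I (As ! j)))))"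
        using tt_meta_congr(4,6) prems by (simp add: As[OF _ _ ts, symmetric])
      show "\<forall>j<length As. deriv \<Sigma> T \<Theta> \<Gamma>'
          (JThesis (EqTerm (map (act I \<sigma>) ss ! j) (map (act I \<sigma>) ts ! j)
            (bsubsts (take j (map (act I \<sigma>) ss)) (inst I (As ! j)))))"
        using tt_meta_congr(3,4,7) prems by (simp add: As[OF _ _ ss, symmetric])
      show "\<forall>C. b = BdTerm C \<longrightarrow> deriv \<Sigma> T \<Theta> \<Gamma>' (JThesis (EqType
          (bsubsts (map (act I \<sigma>) ss) (inst I C)) (bsubsts (map (act I \<sigma>) ts) (inst I C))))"
        using tt_meta_congr(3,4,8) prems by (simp add: C[OF _ _ ss, symmetric] C[OF _ _ ts, symmetric])
    qed (use tt_meta_congr(3,4) in simp_all)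
    then show "deriv \<Sigma> T \<Theta> \<Gamma>' (on_judgement (act I \<sigma>)
        (fill_eq (BThesis (map_bthesis (bsubsts ss) b)) (Meta M ss) (Meta M ts)))"
      using tt_meta_congr(2,3) C[OF _ _ ss] by (cases b) (auto simp: act_Meta simp del: act.simps)
  qed
next
  case (tt_abstr \<Gamma> A a J)
  show ?case
  proof (intro allI impI)
    fix \<Gamma>' \<sigma> assume prems: "good_ctx \<Sigma> \<Xi> \<Gamma>" "Q \<Gamma>'" "typed \<Gamma> \<Gamma>' \<sigma>"
    note ok = typed_ok[OF prems(2,3)]
    \<comment> \<open>The rule is applied to its own premises once more in order to read scoping of
      the unopened body off the conclusion.\<close>
    have AJ: "valid_ty \<Sigma> (mv_arity \<Xi>) (dom_ctx \<Gamma>) 0 A"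
        "valid_judgement \<Sigma> (mv_arity \<Xi>) (dom_ctx \<Gamma>) (Suc 0) J"
      using deriv_valid(1)[OF mctx(2) deriv_deriv_bdry.tt_abstr[OF tt_abstr(1,3,4,5)]] prems(1) by auto
    obtain a' where a': "a' \<notin> dom_ctx \<Gamma>'" using fresh_dom_ctx by blast
    have A': "deriv \<Sigma> T \<Theta> \<Gamma>' (JThesis (IsType (act I \<sigma> A)))" using tt_abstr(2) prems by auto
    have "Q (\<Gamma>' @ [(a', act I \<sigma> A)])"
      using prems(2) a' act_valid[OF AJ(1) ok] by (rule Q_snoc)
    then have "deriv \<Sigma> T \<Theta> (\<Gamma>' @ [(a', act I \<sigma> A)])
        (on_judgement (act I (\<sigma>(a := FVar a'))) (bsubst_judgement 0 (FVar a) J))"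
      using tt_abstr(6) good_ctx_snoc[OF prems(1) AJ(1)] typed_snoc[OF prems tt_abstr(3) a' AJ(1)]
      by blast
    moreover have "on_judgement (act I (\<sigma>(a := FVar a'))) (bsubst_judgement 0 (FVar a) J) =
        bsubst_judgement 0 (FVar a') (on_judgement (act I \<sigma>) J)"
      using AJ(2) tt_abstr(3) act_ok_mono[OF ok subset_insertI] valid_FVar[OF insertI1]
      by (rule act_bsubst_judgement)
    moreover have "a' \<notin> fv_judgement (on_judgement (act I \<sigma>) J)"
      using a' valid_judgement_fv[OF valid_on_judgement[OF AJ(2), of _ _ "act I \<sigma>"]] act_valid[OF _ ok]
      by blast
    ultimately show "deriv \<Sigma> T \<Theta> \<Gamma>' (on_judgement (act I \<sigma>) (JAbs A J))"
      using deriv_deriv_bdry.tt_abstr[OF A' a'] by simp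
  qed
next
  case (bdry_abstr \<Gamma> A a B)
  show ?case
  proof (intro allI impI)
    fix \<Gamma>' \<sigma> assume prems: "good_ctx \<Sigma> \<Xi> \<Gamma>" "Q \<Gamma>'" "typed \<Gamma> \<Gamma>' \<sigma>"
    note ok = typed_ok[OF prems(2,3)]
    have AJ: "valid_ty \<Sigma> (mv_arity \<Xi>) (dom_ctx \<Gamma>) 0 A"
        "valid_boundary \<Sigma> (mv_arity \<Xi>) (dom_ctx \<Gamma>) (Suc 0) B"
      using deriv_valid(2)[OF mctx(2) deriv_deriv_bdry.bdry_abstr[OF bdry_abstr(1,3,4,5)]] prems(1) by auto
    obtain a' where a': "a' \<notin> dom_ctx \<Gamma>'" using fresh_dom_ctx by blast
    have A': "deriv \<Sigma> T \<Theta> \<Gamma>' (JThesis (IsType (act I \<sigma> A)))" using bdry_abstr(2) prems by auto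
    have "Q (\<Gamma>' @ [(a', act I \<sigma> A)])"
      using prems(2) a' act_valid[OF AJ(1) ok] by (rule Q_snoc)
    then have "deriv_bdry \<Sigma> T \<Theta> (\<Gamma>' @ [(a', act I \<sigma> A)])
        (on_boundary (act I (\<sigma>(a := FVar a'))) (bsubst_boundary 0 (FVar a) B))"
      using bdry_abstr(6) good_ctx_snoc[OF prems(1) AJ(1)] typed_snoc[OF prems bdry_abstr(3) a' AJ(1)]
      by blast
    moreover have "on_boundary (act I (\<sigma>(a := FVar a'))) (bsubst_boundary 0 (FVar a) B) =
        bsubst_boundary 0 (FVar a') (on_boundary (act I \<sigma>) B)"
      using AJ(2) bdry_abstr(3) act_ok_mono[OF ok subset_insertI] valid_FVar[OF insertI1]
      by (rule act_bsubst_boundary)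
    moreover have "a' \<notin> fv_boundary (on_boundary (act I \<sigma>) B)"
      using a' valid_boundary_fv[OF valid_on_boundary[OF AJ(2), of _ _ "act I \<sigma>"]] act_valid[OF _ ok]
      by blast
    ultimately show "deriv_bdry \<Sigma> T \<Theta> \<Gamma>' (on_boundary (act I \<sigma>) (BAbs A B))"
      using deriv_deriv_bdry.bdry_abstr[OF A' a'] by simp
  qed
next
  case (tt_rule \<Psi> j \<Gamma> K)
  show ?case
  proof (intro allI impI)
    fix \<Gamma>' \<sigma> assume prems: "good_ctx \<Sigma> \<Xi> \<Gamma>" "Q \<Gamma>'" "typed \<Gamma> \<Gamma>' \<sigma>"
    note ok = typed_ok[OF prems(2,3)] and rule = rule_valid[OF tt_rule(1)]
    have j: "map_jthesis (act I \<sigma>) (inst_jthesis K j) = inst_jthesis (map_inst (act I \<sigma>) K) j"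
      using rule(2) tt_rule(2) ok by (rule act_inst_jthesis)
    have "deriv \<Sigma> T \<Theta> \<Gamma>' (JThesis (inst_jthesis (map_inst (act I \<sigma>) K) j))"
      using tt_rule(1) is_inst_map_inst[OF tt_rule(2) ok]
    proof (rule deriv_deriv_bdry.tt_rule)
      show "\<forall>i<length \<Psi>. deriv \<Sigma> T \<Theta> \<Gamma>' (inst_premise (map_inst (act I \<sigma>) K) \<Psi> i)"
        using tt_rule(3) prems act_inst_premise[OF rule(1) tt_rule(2) ok] by metis
      show "deriv_bdry \<Sigma> T \<Theta> \<Gamma>' (BThesis (inst_bthesis (map_inst (act I \<sigma>) K) (boundary_of j)))"
        using tt_rule(5) prems j by (metis on_boundary.simps(1) map_bthesis_boundary_of)
    qed
    then show "deriv \<Sigma> T \<Theta> \<Gamma>' (on_judgement (act I \<sigma>) (JThesis (inst_jthesis K j)))"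
      using j by simp
  qed
next
  case (tt_congr_ty \<Psi> A \<Gamma> K L)
  show ?case
  proof (intro allI impI)
    fix \<Gamma>' \<sigma> assume prems: "good_ctx \<Sigma> \<Xi> \<Gamma>" "Q \<Gamma>'" "typed \<Gamma> \<Gamma>' \<sigma>"
    note ok = typed_ok[OF prems(2,3)] and rule = rule_valid[OF tt_congr_ty(1)]
    have "deriv \<Sigma> T \<Theta> \<Gamma>'
        (JThesis (EqType (inst (map_inst (act I \<sigma>) K) A) (inst (map_inst (act I \<sigma>) L) A)))"
      using tt_congr_ty(1) is_inst_map_inst[OF tt_congr_ty(2) ok] is_inst_map_inst[OF tt_congr_ty(3) ok]
    proof (rule deriv_deriv_bdry.tt_congr_ty)
      show "\<forall>i<length \<Psi>. deriv \<Sigma> T \<Theta> \<Gamma>' (inst_premise (map_inst (act I \<sigma>) K) \<Psi> i)"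
        using tt_congr_ty(4) prems act_inst_premise[OF rule(1) tt_congr_ty(2) ok] by metis
      show "\<forall>i<length \<Psi>. deriv \<Sigma> T \<Theta> \<Gamma>' (inst_premise (map_inst (act I \<sigma>) L) \<Psi> i)"
        using tt_congr_ty(5) prems act_inst_premise[OF rule(1) tt_congr_ty(3) ok] by metis
      show "\<forall>i<length \<Psi>. object_boundary (snd (\<Psi> ! i)) \<longrightarrow>
          deriv \<Sigma> T \<Theta> \<Gamma>' (inst_eq_premise (map_inst (act I \<sigma>) K) (map_inst (act I \<sigma>) L) \<Psi> i)"
        using tt_congr_ty(6) prems act_inst_eq_premise[OF rule(1) tt_congr_ty(2,3) ok] by metis
    qed
    then show "deriv \<Sigma> T \<Theta> \<Gamma>' (on_judgement (act I \<sigma>) (JThesis (EqType (inst K A) (inst L A))))"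
      using act_inst_jthesis[OF rule(2) tt_congr_ty(2) ok] act_inst_jthesis[OF rule(2) tt_congr_ty(3) ok]
      by simp
  qed
next
  case (tt_congr_tm \<Psi> t A \<Gamma> K L)
  show ?case
  proof (intro allI impI)
    fix \<Gamma>' \<sigma> assume prems: "good_ctx \<Sigma> \<Xi> \<Gamma>" "Q \<Gamma>'" "typed \<Gamma> \<Gamma>' \<sigma>"
    note ok = typed_ok[OF prems(2,3)] and rule = rule_valid[OF tt_congr_tm(1)]
    note tA = act_inst_jthesis[OF rule(2) tt_congr_tm(2) ok] act_inst_jthesis[OF rule(2) tt_congr_tm(3) ok]
    have "deriv \<Sigma> T \<Theta> \<Gamma>' (JThesis (EqTerm (inst (map_inst (act I \<sigma>) K) t)
        (inst (map_inst (act I \<sigma>) L) t) (inst (map_inst (act I \<sigma>) K) A)))"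
      using tt_congr_tm(1) is_inst_map_inst[OF tt_congr_tm(2) ok] is_inst_map_inst[OF tt_congr_tm(3) ok]
    proof (rule deriv_deriv_bdry.tt_congr_tm)
      show "\<forall>i<length \<Psi>. deriv \<Sigma> T \<Theta> \<Gamma>' (inst_premise (map_inst (act I \<sigma>) K) \<Psi> i)"
        using tt_congr_tm(4) prems act_inst_premise[OF rule(1) tt_congr_tm(2) ok] by metis
      show "\<forall>i<length \<Psi>. deriv \<Sigma> T \<Theta> \<Gamma>' (inst_premise (map_inst (act I \<sigma>) L) \<Psi> i)"
        using tt_congr_tm(5) prems act_inst_premise[OF rule(1) tt_congr_tm(3) ok] by metis
      show "\<forall>i<length \<Psi>. object_boundary (snd (\<Psi> ! i)) \<longrightarrow>
          deriv \<Sigma> T \<Theta> \<Gamma>' (inst_eq_premise (map_inst (act I \<sigma>) K) (map_inst (act I \<sigma>) L) \<Psi> i)"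
        using tt_congr_tm(6) prems act_inst_eq_premise[OF rule(1) tt_congr_tm(2,3) ok] by metis
      have "deriv \<Sigma> T \<Theta> \<Gamma>' (on_judgement (act I \<sigma>) (JThesis (EqType (inst K A) (inst L A))))"
        using tt_congr_tm(8) prems by blast
      then show "deriv \<Sigma> T \<Theta> \<Gamma>'
          (JThesis (EqType (inst (map_inst (act I \<sigma>) K) A) (inst (map_inst (act I \<sigma>) L) A)))"
        using tA by simp
    qed
    then show "deriv \<Sigma> T \<Theta> \<Gamma>'
        (on_judgement (act I \<sigma>) (JThesis (EqTerm (inst K t) (inst L t) (inst K A))))"
      using tA by simp
  qed
next
  case tt_eqty_refl
  then show ?case by simp (blast intro: deriv_deriv_bdry.tt_eqty_refl)
next
  case tt_eqty_sym
  then show ?case by simp (blast intro: deriv_deriv_bdry.tt_eqty_sym)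
next
  case tt_eqty_trans
  then show ?case by simp (blast intro: deriv_deriv_bdry.tt_eqty_trans)
next
  case tt_eqtm_refl
  then show ?case by simp (blast intro: deriv_deriv_bdry.tt_eqtm_refl)
next
  case tt_eqtm_sym
  then show ?case by simp (blast intro: deriv_deriv_bdry.tt_eqtm_sym)
next
  case tt_eqtm_trans
  then show ?case by simp (blast intro: deriv_deriv_bdry.tt_eqtm_trans)
next
  case tt_conv_tm
  then show ?case by simp (blast intro: deriv_deriv_bdry.tt_conv_tm)
next
  case tt_conv_eqtm
  then show ?case by simp (blast intro: deriv_deriv_bdry.tt_conv_eqtm)
next
  case bdry_ty
  then show ?case by (simp add: deriv_deriv_bdry.bdry_ty)
next
  case bdry_tm
  then show ?case by simp (blast intro: deriv_deriv_bdry.bdry_tm)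
next
  case bdry_eqty
  then show ?case by simp (blast intro: deriv_deriv_bdry.bdry_eqty)
next
  case bdry_eqtm
  then show ?case by simp (blast intro: deriv_deriv_bdry.bdry_eqtm)
qed

end


section \<open>Weakening and substitution\<close>

lemma inst_Nil_id: "inst [] = id"
  by auto

lemma meta_head_Nil [simp]: "meta_head [] M ts = Meta M ts"
  by (simp add: meta_head_def)

context raw_tt
begin

text \<open>The identity is a well-typed renaming into the longer context, and it acts trivially.
  Its content lies at binders: the derivation may have used \<open>a\<close> as one of its fresh
  names, and \<open>deriv_act\<close> then chooses another.\<close>

lemma weakening:
  assumes "is_mctx \<Sigma> \<Theta>" "good_ctx \<Sigma> \<Theta> \<Gamma>" "a \<notin> dom_ctx \<Gamma>"
    "valid_ty \<Sigma> (mv_arity \<Theta>) (dom_ctx \<Gamma>) 0 A" "deriv \<Sigma> T \<Theta> \<Gamma> J"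
  shows "deriv \<Sigma> T \<Theta> (\<Gamma> @ [(a, A)]) J"
proof -
  interpret derivation_action \<Sigma> T \<Theta> \<Theta> "[]" "\<lambda>\<Gamma>. good_ctx \<Sigma> \<Theta> \<Gamma>"
    "\<lambda>\<Gamma> t A. \<exists>a. t = FVar a \<and> map_of \<Gamma> a = Some A"
  proof
    show "\<exists>b. FVar a = FVar b \<and> map_of (\<Gamma> @ [(a, A)]) b = Some A"
      if "a \<notin> dom_ctx \<Gamma>" for \<Gamma> a A
      using map_of_snoc_fresh[OF that] by blast
  qed (use assms(1) in \<open>auto simp: act_ok_Nil good_ctx_snoc map_of_snoc inst_Nil_id bthesis.map_id
      intro: deriv_deriv_bdry.tt_var deriv_deriv_bdry.tt_meta deriv_deriv_bdry.tt_meta_congr\<close>)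
  have "typed \<Gamma> (\<Gamma> @ [(a, A)]) FVar" by (auto simp: typed_def map_of_snoc)
  then have "deriv \<Sigma> T \<Theta> (\<Gamma> @ [(a, A)]) (on_judgement (act [] FVar) J)"
    using deriv_act(1)[OF assms(5)] assms(2) good_ctx_snoc[OF assms(2,4)] by blast
  then show ?thesis by (simp add: on_judgement_id)
qed

section \<open>Substitution of derivable terms and of equal terms\<close>

definition typed_subst :: "'s mctx \<Rightarrow> 's vctx \<Rightarrow> 's vctx \<Rightarrow> (fvar \<Rightarrow> 's expr) \<Rightarrow> bool" where
  "typed_subst \<Theta> \<Gamma> \<Gamma>' \<sigma> \<longleftrightarrow>
     (\<forall>a A. map_of \<Gamma> a = Some A \<longrightarrow> deriv \<Sigma> T \<Theta> \<Gamma>' (JThesis (IsTerm (\<sigma> a) (act [] \<sigma> A))))"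

theorem deriv_subst:
  assumes "is_mctx \<Sigma> \<Theta>" "good_ctx \<Sigma> \<Theta> \<Gamma>" "good_ctx \<Sigma> \<Theta> \<Gamma>'" "typed_subst \<Theta> \<Gamma> \<Gamma>' \<sigma>"
    "deriv \<Sigma> T \<Theta> \<Gamma> J"
  shows "deriv \<Sigma> T \<Theta> \<Gamma>' (on_judgement (act [] \<sigma>) J)"
proof -
  interpret derivation_action \<Sigma> T \<Theta> \<Theta> "[]" "\<lambda>\<Gamma>. good_ctx \<Sigma> \<Theta> \<Gamma>"
    "\<lambda>\<Gamma> t A. deriv \<Sigma> T \<Theta> \<Gamma> (JThesis (IsTerm t A))"
  proof
    show "deriv \<Sigma> T \<Theta> (\<Gamma> @ [(a, A)]) (JThesis (IsTerm (FVar a) A))"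
      if "a \<notin> dom_ctx \<Gamma>" for \<Gamma> a A
      using map_of_snoc_fresh[OF that] by (rule deriv_deriv_bdry.tt_var)
  qed (use assms(1) in \<open>auto simp: act_ok_Nil good_ctx_snoc map_of_snoc inst_Nil_id bthesis.map_id
      intro: weakening deriv_deriv_bdry.tt_meta deriv_deriv_bdry.tt_meta_congr\<close>)
  have "typed \<Gamma> \<Gamma>' \<sigma>" using assms(4) by (auto simp: typed_def typed_subst_def)
  then show ?thesis
    using deriv_act(1)[OF assms(5)] assms(2,3) by blast
qed

lemma typed_subst_ok:
  assumes "is_mctx \<Sigma> \<Theta>" "good_ctx \<Sigma> \<Theta> \<Gamma>'" "typed_subst \<Theta> \<Gamma> \<Gamma>' \<sigma>"
  shows "act_ok \<Sigma> (mv_arity \<Theta>) (dom_ctx \<Gamma>) (mv_arity \<Theta>) (dom_ctx \<Gamma>') [] \<sigma>"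
  unfolding act_ok_Nil
proof
  fix a assume "a \<in> dom_ctx \<Gamma>"
  then have "map_of \<Gamma> a \<noteq> None" by (simp add: map_of_eq_None_iff)
  then obtain A where "map_of \<Gamma> a = Some A" by blast
  then have "deriv \<Sigma> T \<Theta> \<Gamma>' (JThesis (IsTerm (\<sigma> a) (act [] \<sigma> A)))"
    using assms(3) by (simp add: typed_subst_def)
  then show "valid_tm \<Sigma> (mv_arity \<Theta>) (dom_ctx \<Gamma>') 0 (\<sigma> a)"
    by (rule deriv_term_valid[OF assms(1,2)])
qed

text \<open>The two images of a type can differ as expressions, so each substitution is typed at its
  own image. The equations are stated at the image under \<open>\<sigma>\<close>, matching the
  asymmetry of the congruence rules.\<close>

definition eq_subst ::
  "'s mctx \<Rightarrow> 's vctx \<Rightarrow> 's vctx \<Rightarrow> (fvar \<Rightarrow> 's expr) \<Rightarrow> (fvar \<Rightarrow> 's expr) \<Rightarrow> bool" where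
  "eq_subst \<Theta> \<Gamma> \<Gamma>' \<sigma> \<tau> \<longleftrightarrow> typed_subst \<Theta> \<Gamma> \<Gamma>' \<sigma> \<and> typed_subst \<Theta> \<Gamma> \<Gamma>' \<tau> \<and>
     (\<forall>a A. map_of \<Gamma> a = Some A \<longrightarrow> deriv \<Sigma> T \<Theta> \<Gamma>' (JThesis (EqTerm (\<sigma> a) (\<tau> a) (act [] \<sigma> A))))"

lemma eq_subst_upd:
  assumes "good_ctx \<Sigma> \<Theta> \<Gamma>" "eq_subst \<Theta> \<Gamma> \<Gamma>' \<sigma> \<tau>" "a \<notin> dom_ctx \<Gamma>"
    "valid_ty \<Sigma> (mv_arity \<Theta>) (dom_ctx \<Gamma>) 0 A"
    "deriv \<Sigma> T \<Theta> \<Gamma>' (JThesis (IsTerm s (act [] \<sigma> A)))"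
    "deriv \<Sigma> T \<Theta> \<Gamma>' (JThesis (IsTerm t (act [] \<tau> A)))"
    "deriv \<Sigma> T \<Theta> \<Gamma>' (JThesis (EqTerm s t (act [] \<sigma> A)))"
  shows "eq_subst \<Theta> (\<Gamma> @ [(a, A)]) \<Gamma>' (\<sigma>(a := s)) (\<tau>(a := t))"
proof -
  have "deriv \<Sigma> T \<Theta> \<Gamma>' (JThesis (IsTerm ((\<sigma>(a := s)) b) (act [] (\<sigma>(a := s)) B))) \<and>
      deriv \<Sigma> T \<Theta> \<Gamma>' (JThesis (IsTerm ((\<tau>(a := t)) b) (act [] (\<tau>(a := t)) B))) \<and>
      deriv \<Sigma> T \<Theta> \<Gamma>'
        (JThesis (EqTerm ((\<sigma>(a := s)) b) ((\<tau>(a := t)) b) (act [] (\<sigma>(a := s)) B)))"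
    if b: "map_of (\<Gamma> @ [(a, A)]) b = Some B" for b B
  proof (cases "map_of \<Gamma> b")
    case None
    then have "b = a" "B = A" using b by (auto simp: map_of_snoc split: if_splits)
    then show ?thesis using assms(5-7) act_upd_fresh[OF assms(4,3)] by simp
  next
    case (Some C)
    then have bB: "b \<noteq> a" "map_of \<Gamma> b = Some B" using b assms(3) by (force simp: map_of_snoc dest: map_of_SomeD)+
    then have "valid_ty \<Sigma> (mv_arity \<Theta>) (dom_ctx \<Gamma>) 0 B" using assms(1) by (simp add: good_ctx_def)
    from act_upd_fresh[OF this assms(3)] show ?thesis
      using assms(2) bB by (simp add: eq_subst_def typed_subst_def)
  qed
  then show ?thesis unfolding eq_subst_def typed_subst_def by blast
qed

lemma eq_subst_weaken:
  assumes "is_mctx \<Sigma> \<Theta>" "good_ctx \<Sigma> \<Theta> \<Gamma>'" "eq_subst \<Theta> \<Gamma> \<Gamma>' \<sigma> \<tau>" "a \<notin> dom_ctx \<Gamma>'"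
    "valid_ty \<Sigma> (mv_arity \<Theta>) (dom_ctx \<Gamma>') 0 A"
  shows "eq_subst \<Theta> \<Gamma> (\<Gamma>' @ [(a, A)]) \<sigma> \<tau>"
  using assms(3) weakening[OF assms(1,2,4,5)] by (simp add: eq_subst_def typed_subst_def)

text \<open>The new variable is declared with type \<open>act [] \<sigma> A\<close>, whereas
  \<open>\<tau>\<close> needs it at type \<open>act [] \<tau> A\<close>. Conversion along the
  weakened type equation supplies that second typing.\<close>

lemma eq_subst_snoc:
  assumes "is_mctx \<Sigma> \<Theta>" "good_ctx \<Sigma> \<Theta> \<Gamma>" "good_ctx \<Sigma> \<Theta> \<Gamma>'" "eq_subst \<Theta> \<Gamma> \<Gamma>' \<sigma> \<tau>"
    "a \<notin> dom_ctx \<Gamma>" "a' \<notin> dom_ctx \<Gamma>'" "valid_ty \<Sigma> (mv_arity \<Theta>) (dom_ctx \<Gamma>) 0 A"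
    "deriv \<Sigma> T \<Theta> \<Gamma>' (JThesis (EqType (act [] \<sigma> A) (act [] \<tau> A)))"
  shows "eq_subst \<Theta> (\<Gamma> @ [(a, A)]) (\<Gamma>' @ [(a', act [] \<sigma> A)]) (\<sigma>(a := FVar a')) (\<tau>(a := FVar a'))"
proof -
  have A: "valid_ty \<Sigma> (mv_arity \<Theta>) (dom_ctx \<Gamma>') 0 (act [] \<sigma> A)"
    using act_valid[OF assms(7) typed_subst_ok[OF assms(1,3)]] assms(4) by (simp add: eq_subst_def)
  have a': "deriv \<Sigma> T \<Theta> (\<Gamma>' @ [(a', act [] \<sigma> A)]) (JThesis (IsTerm (FVar a') (act [] \<sigma> A)))"
    using map_of_snoc_fresh[OF assms(6)] by (rule deriv_deriv_bdry.tt_var)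
  show ?thesis
    using assms(2) eq_subst_weaken[OF assms(1,3,4,6) A] assms(5,7) a'
      deriv_deriv_bdry.tt_conv_tm[OF a' weakening[OF assms(1,3,6) A assms(8)]]
      deriv_deriv_bdry.tt_eqtm_refl[OF a']
    by (rule eq_subst_upd)
qed

lemma eq_subst_FVar: "eq_subst \<Theta> \<Gamma> \<Gamma> FVar FVar"
  by (auto simp: eq_subst_def typed_subst_def intro: deriv_deriv_bdry.tt_var deriv_deriv_bdry.tt_eqtm_refl)

end

text \<open>The values at equality theses are defaults; only object judgements are ever used.\<close>

primrec eq_jthesis :: "('s expr \<Rightarrow> 's expr) \<Rightarrow> ('s expr \<Rightarrow> 's expr) \<Rightarrow> 's expr jthesis \<Rightarrow> 's expr jthesis" where
  "eq_jthesis f g (IsType A) = EqType (f A) (g A)"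
| "eq_jthesis f g (IsTerm t A) = EqTerm (f t) (g t) (f A)"
| "eq_jthesis f g (EqType A B) = EqType (f A) (f B)"
| "eq_jthesis f g (EqTerm s t A) = EqTerm (f s) (f t) (f A)"

primrec eq_judgement :: "('s expr \<Rightarrow> 's expr) \<Rightarrow> ('s expr \<Rightarrow> 's expr) \<Rightarrow> 's judgement \<Rightarrow> 's judgement" where
  "eq_judgement f g (JThesis j) = JThesis (eq_jthesis f g j)"
| "eq_judgement f g (JAbs A J) = JAbs (f A) (eq_judgement f g J)"

primrec object_judgement :: "'s judgement \<Rightarrow> bool" where
  "object_judgement (JThesis j) \<longleftrightarrow> class_bthesis (boundary_of j) \<in> {Ty, Tm}"
| "object_judgement (JAbs A J) \<longleftrightarrow> object_judgement J"

lemma object_judgement_bsubst [simp]: "object_judgement (bsubst_judgement k u J) \<longleftrightarrow> object_judgement J"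
proof (induction J arbitrary: k u)
  case (JThesis j)
  then show ?case by (cases j) auto
qed simp

lemma valid_eq_judgement:
  "valid_judgement \<Sigma> \<Phi> V d J \<Longrightarrow> (\<And>d ar e. valid_arg \<Sigma> \<Phi> V d ar e \<Longrightarrow> valid_arg \<Sigma> \<Phi>' V' d ar (f e))
    \<Longrightarrow> (\<And>d ar e. valid_arg \<Sigma> \<Phi> V d ar e \<Longrightarrow> valid_arg \<Sigma> \<Phi>' V' d ar (g e))
    \<Longrightarrow> valid_judgement \<Sigma> \<Phi>' V' d (eq_judgement f g J)"
proof (induction J arbitrary: d)
  case (JThesis j)
  then show ?case by (cases j) auto
qed simp

lemma eq_judgement_bsubst:
  assumes "valid_judgement \<Sigma> \<Phi> V d J" "a \<notin> V" "act_ok \<Sigma> \<Phi> V \<Phi>' V' I \<sigma>" "act_ok \<Sigma> \<Phi> V \<Phi>' V' I \<tau>"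
    "valid_tm \<Sigma> \<Phi>' V' 0 t"
  shows "eq_judgement (act I (\<sigma>(a := t))) (act I (\<tau>(a := t))) (bsubst_judgement k (FVar a) J) =
    bsubst_judgement k t (eq_judgement (act I \<sigma>) (act I \<tau>) J)"
proof -
  note * = act_bsubst_FVar[OF _ assms(2,3,5)] act_bsubst_FVar[OF _ assms(2,4,5)]
  show ?thesis
    using assms(1)
  proof (induction J arbitrary: d k)
    case (JThesis j)
    then show ?case by (cases j) (auto simp: * simp del: fun_upd_apply)
  qed (auto simp: * valid_lift_id[OF assms(5)] simp del: fun_upd_apply)
qed

lemma object_judgement_fill:
  "has_abs (abs_depth B) e \<Longrightarrow> object_judgement (fill B e) \<longleftrightarrow> object_boundary B"
proof (induction B arbitrary: e)
  case (BThesis b)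
  then show ?case by (cases b) auto
qed auto

lemma eq_judgement_fill:
  "object_boundary B \<Longrightarrow> has_abs (abs_depth B) e \<Longrightarrow> f = act I \<sigma> \<Longrightarrow> g = act K \<tau> \<Longrightarrow>
    eq_judgement f g (fill B e) = fill_eq (on_boundary f B) (f e) (g e)"
proof (induction B arbitrary: e)
  case (BThesis b)
  then show ?case by (cases b) auto
qed auto

text \<open>The induction hypothesis for a premise of a rule, under two equal substitutions, is
  thereby exactly the equational premise of the congruence rule at the two composed
  instantiations.\<close>

lemma eq_inst_premise:
  assumes "is_mctx \<Sigma> \<Xi>" "is_inst \<Sigma> \<Psi> \<Gamma> \<Xi> K" "act_ok \<Sigma> (mv_arity \<Psi>) (dom_ctx \<Gamma>) \<Phi> V I \<sigma>"
    "i < length \<Xi>" "object_boundary (snd (\<Xi> ! i))"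
  shows "eq_judgement (act I \<sigma>) (act I \<tau>) (inst_premise K \<Xi> i) =
    inst_eq_premise (map_inst (act I \<sigma>) K) (map_inst (act I \<tau>) K) \<Xi> i"
  using assms(4,5) act_inst_boundary_take[OF assms(1-4)]
    is_inst_has_abs[OF assms(2,4)] is_inst_length[OF assms(2)]
  by (simp add: inst_eq_premise_def inst_premise_def eq_judgement_fill inst_boundary_eq snd_nth_map_inst)

lemma object_inst_premise:
  assumes "is_inst \<Sigma> \<Psi> \<Gamma> \<Xi> K" "i < length \<Xi>"
  shows "object_judgement (inst_premise K \<Xi> i) \<longleftrightarrow> object_boundary (snd (\<Xi> ! i))"
  using is_inst_has_abs[OF assms]
  by (simp add: inst_premise_def inst_boundary_eq object_judgement_fill)

section \<open>Equal substitutions yield derivable equations\<close>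

context raw_tt
begin

text \<open>A metavariable or a specific rule is answered by its congruence rule, which at a term
  boundary also asks for equality of the two types. The clause for boundaries extracts this equation
  from the boundary premise, hence its restriction to \<open>BdTerm\<close>. Rules concluding
  equations are excluded by \<open>object_judgement\<close>.\<close>

theorem deriv_eq_subst:
  assumes \<Theta>: "is_mctx \<Sigma> \<Theta>"
  shows "deriv \<Sigma> T \<Theta> \<Gamma> J \<Longrightarrow>
      \<forall>\<Gamma>' \<sigma> \<tau>. good_ctx \<Sigma> \<Theta> \<Gamma> \<longrightarrow> good_ctx \<Sigma> \<Theta> \<Gamma>' \<longrightarrow> eq_subst \<Theta> \<Gamma> \<Gamma>' \<sigma> \<tau> \<longrightarrow> object_judgement J
        \<longrightarrow> deriv \<Sigma> T \<Theta> \<Gamma>' (eq_judgement (act [] \<sigma>) (act [] \<tau>) J)"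
    and "deriv_bdry \<Sigma> T \<Theta> \<Delta> B \<Longrightarrow>
      \<forall>\<Gamma>' \<sigma> \<tau> A. good_ctx \<Sigma> \<Theta> \<Delta> \<longrightarrow> good_ctx \<Sigma> \<Theta> \<Gamma>' \<longrightarrow> eq_subst \<Theta> \<Delta> \<Gamma>' \<sigma> \<tau> \<longrightarrow> B = BThesis (BdTerm A)
        \<longrightarrow> deriv \<Sigma> T \<Theta> \<Gamma>' (JThesis (EqType (act [] \<sigma> A) (act [] \<tau> A)))"
proof (induct rule: deriv_deriv_bdry.inducts)
  case (tt_var \<Gamma> a A)
  then show ?case by (auto simp: eq_subst_def)
next
  case (tt_meta M As b ts \<Gamma>)
  show ?case
  proof (intro allI impI)
    fix \<Gamma>' \<sigma> \<tau> assume prems: "good_ctx \<Sigma> \<Theta> \<Gamma>" "good_ctx \<Sigma> \<Theta> \<Gamma>'" "eq_subst \<Theta> \<Gamma> \<Gamma>' \<sigma> \<tau>"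
      and obj: "object_judgement (JThesis (fill_thesis (map_bthesis (bsubsts ts) b) (Meta M ts)))"
    have \<sigma>: "typed_subst \<Theta> \<Gamma> \<Gamma>' \<sigma>" and \<tau>: "typed_subst \<Theta> \<Gamma> \<Gamma>' \<tau>"
      using prems(3) by (auto simp: eq_subst_def)
    have ts: "\<forall>t \<in> set ts. valid_tm \<Sigma> (mv_arity \<Theta>) (dom_ctx \<Gamma>) 0 t"
      using tt_meta(3) by (intro deriv_terms_valid[OF \<Theta> prems(1) tt_meta(2)]) blast
    have As: "act [] \<rho> (bsubsts (take j ts) (As ! j)) = bsubsts (take j (map (act [] \<rho>) ts)) (As ! j)"
      if "j < length As" "typed_subst \<Theta> \<Gamma> \<Gamma>' \<rho>" for j \<rho>
      using act_bsubsts_closed[OF _ typed_subst_ok[OF \<Theta> prems(2) that(2)], of "take j ts" Ty "As ! j"]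
        ts that tt_meta(2) mctx_telescope_valid(1)[OF \<Theta> tt_meta(1) that(1)]
      by (auto simp: take_map dest: in_set_takeD)
    have C: "act [] \<rho> (bsubsts ts C) = bsubsts (map (act [] \<rho>) ts) C"
      if "b = BdTerm C" "typed_subst \<Theta> \<Gamma> \<Gamma>' \<rho>" for C \<rho>
      using act_bsubsts_closed[OF _ typed_subst_ok[OF \<Theta> prems(2) that(2)] ts, of Ty C]
        that tt_meta(2) mctx_telescope_valid(2)[OF \<Theta> tt_meta(1)]
      by auto
    \<comment> \<open>Typing of the arguments is needed under each substitution separately. It is
      not part of the induction hypothesis, which yields only equations, but follows from
      \<open>deriv_subst\<close>.\<close>
    have typed: "\<forall>j<length As. deriv \<Sigma> T \<Theta> \<Gamma>' (JThesis (IsTerm (map (act [] \<rho>) ts ! j)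
          (bsubsts (take j (map (act [] \<rho>) ts)) (As ! j))))" if "typed_subst \<Theta> \<Gamma> \<Gamma>' \<rho>" for \<rho>
    proof (intro allI impI)
      fix j assume j: "j < length As"
      have "deriv \<Sigma> T \<Theta> \<Gamma>'
          (on_judgement (act [] \<rho>) (JThesis (IsTerm (ts ! j) (bsubsts (take j ts) (As ! j)))))"
        using \<Theta> prems(1,2) that by (rule deriv_subst) (use tt_meta(3) j in blast)
      then show "deriv \<Sigma> T \<Theta> \<Gamma>' (JThesis (IsTerm (map (act [] \<rho>) ts ! j)
          (bsubsts (take j (map (act [] \<rho>) ts)) (As ! j))))"
        using As[OF j that] j tt_meta(2) by simp
    qed
    have "deriv \<Sigma> T \<Theta> \<Gamma>' (fill_eq (BThesis (map_bthesis (bsubsts (map (act [] \<sigma>) ts)) b))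
        (Meta M (map (act [] \<sigma>) ts)) (Meta M (map (act [] \<tau>) ts)))"
      using tt_meta(1)
    proof (rule deriv_deriv_bdry.tt_meta_congr)
      show "class_bthesis b \<in> {Ty, Tm}" using obj by (cases b) auto
      show "\<forall>j<length As. deriv \<Sigma> T \<Theta> \<Gamma>'
          (JThesis (EqTerm (map (act [] \<sigma>) ts ! j) (map (act [] \<tau>) ts ! j)
            (bsubsts (take j (map (act [] \<sigma>) ts)) (As ! j))))"
        using tt_meta(2,3) prems by (simp add: As[OF _ \<sigma>, symmetric])
      show "\<forall>C. b = BdTerm C \<longrightarrow> deriv \<Sigma> T \<Theta> \<Gamma>' (JThesis (EqType
          (bsubsts (map (act [] \<sigma>) ts) C) (bsubsts (map (act [] \<tau>) ts) C)))"
        using tt_meta(5) prems by (simp add: C[OF _ \<sigma>, symmetric] C[OF _ \<tau>, symmetric])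
    qed (use tt_meta(2) typed[OF \<sigma>] typed[OF \<tau>] in simp_all)
    then show "deriv \<Sigma> T \<Theta> \<Gamma>' (eq_judgement (act [] \<sigma>) (act [] \<tau>)
        (JThesis (fill_thesis (map_bthesis (bsubsts ts) b) (Meta M ts))))"
      using obj C[OF _ \<sigma>] by (cases b) auto
  qed
next
  case (tt_meta_congr M As b ss ts \<Gamma>)
  \<comment> \<open>For each object boundary the conclusion is an equation, so it is not an object
    judgement.\<close>
  then show ?case by (cases b) auto
next
  case (tt_abstr \<Gamma> A a J)
  show ?case
  proof (intro allI impI)
    fix \<Gamma>' \<sigma> \<tau> assume prems: "good_ctx \<Sigma> \<Theta> \<Gamma>" "good_ctx \<Sigma> \<Theta> \<Gamma>'" "eq_subst \<Theta> \<Gamma> \<Gamma>' \<sigma> \<tau>"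
      and obj: "object_judgement (JAbs A J)"
    have \<sigma>: "typed_subst \<Theta> \<Gamma> \<Gamma>' \<sigma>" and \<tau>: "typed_subst \<Theta> \<Gamma> \<Gamma>' \<tau>"
      using prems(3) by (auto simp: eq_subst_def)
    note ok = typed_subst_ok[OF \<Theta> prems(2) \<sigma>] typed_subst_ok[OF \<Theta> prems(2) \<tau>]
    have AJ: "valid_ty \<Sigma> (mv_arity \<Theta>) (dom_ctx \<Gamma>) 0 A"
        "valid_judgement \<Sigma> (mv_arity \<Theta>) (dom_ctx \<Gamma>) (Suc 0) J"
      using deriv_valid(1)[OF \<Theta> deriv_deriv_bdry.tt_abstr[OF tt_abstr(1,3,4,5)]] prems(1) by auto
    obtain a' where a': "a' \<notin> dom_ctx \<Gamma>'" using fresh_dom_ctx by blast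
    have A': "deriv \<Sigma> T \<Theta> \<Gamma>' (JThesis (IsType (act [] \<sigma> A)))"
      using deriv_subst[OF \<Theta> prems(1,2) \<sigma> tt_abstr(1)] by simp
    have AA: "deriv \<Sigma> T \<Theta> \<Gamma>' (JThesis (EqType (act [] \<sigma> A) (act [] \<tau> A)))"
      using tt_abstr(2) prems by simp
    have "deriv \<Sigma> T \<Theta> (\<Gamma>' @ [(a', act [] \<sigma> A)])
        (eq_judgement (act [] (\<sigma>(a := FVar a'))) (act [] (\<tau>(a := FVar a'))) (bsubst_judgement 0 (FVar a) J))"
      using tt_abstr(6) good_ctx_snoc[OF prems(1) AJ(1)] good_ctx_snoc[OF prems(2) act_valid[OF AJ(1) ok(1)]]
        eq_subst_snoc[OF \<Theta> prems tt_abstr(3) a' AJ(1) AA] obj by simp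
    moreover have "eq_judgement (act [] (\<sigma>(a := FVar a'))) (act [] (\<tau>(a := FVar a'))) (bsubst_judgement 0 (FVar a) J) =
        bsubst_judgement 0 (FVar a') (eq_judgement (act [] \<sigma>) (act [] \<tau>) J)"
      using AJ(2) tt_abstr(3) act_ok_mono[OF ok(1) subset_insertI] act_ok_mono[OF ok(2) subset_insertI]
        valid_FVar[OF insertI1]
      by (rule eq_judgement_bsubst)
    moreover have "a' \<notin> fv_judgement (eq_judgement (act [] \<sigma>) (act [] \<tau>) J)"
      using a' valid_judgement_fv[OF valid_eq_judgement[OF AJ(2), of _ _ "act [] \<sigma>" "act [] \<tau>"]]
        act_valid[OF _ ok(1)] act_valid[OF _ ok(2)]
      by blast
    ultimately show "deriv \<Sigma> T \<Theta> \<Gamma>' (eq_judgement (act [] \<sigma>) (act [] \<tau>) (JAbs A J))"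
      using deriv_deriv_bdry.tt_abstr[OF A' a'] by simp
  qed
next
  case (tt_conv_tm \<Gamma> t A B)
  show ?case
  proof (intro allI impI)
    fix \<Gamma>' \<sigma> \<tau> assume prems: "good_ctx \<Sigma> \<Theta> \<Gamma>" "good_ctx \<Sigma> \<Theta> \<Gamma>'" "eq_subst \<Theta> \<Gamma> \<Gamma>' \<sigma> \<tau>"
    \<comment> \<open>The goal is an equation at \<open>act [] \<sigma> B\<close>, so the type
      equation is transported along \<open>\<sigma>\<close> on both sides.\<close>
    have "deriv \<Sigma> T \<Theta> \<Gamma>' (JThesis (EqType (act [] \<sigma> A) (act [] \<sigma> B)))"
      using deriv_subst[OF \<Theta> prems(1,2) _ tt_conv_tm(3)] prems(3) by (simp add: eq_subst_def)
    moreover have "deriv \<Sigma> T \<Theta> \<Gamma>' (JThesis (EqTerm (act [] \<sigma> t) (act [] \<tau> t) (act [] \<sigma> A)))"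
      using tt_conv_tm(2) prems by simp
    ultimately show "deriv \<Sigma> T \<Theta> \<Gamma>' (eq_judgement (act [] \<sigma>) (act [] \<tau>) (JThesis (IsTerm t B)))"
      by (simp add: deriv_deriv_bdry.tt_conv_eqtm)
  qed
next
  case (tt_rule \<Xi> j \<Gamma> K)
  show ?case
  proof (intro allI impI)
    fix \<Gamma>' \<sigma> \<tau> assume prems: "good_ctx \<Sigma> \<Theta> \<Gamma>" "good_ctx \<Sigma> \<Theta> \<Gamma>'" "eq_subst \<Theta> \<Gamma> \<Gamma>' \<sigma> \<tau>"
      and obj: "object_judgement (JThesis (inst_jthesis K j))"
    have \<sigma>: "typed_subst \<Theta> \<Gamma> \<Gamma>' \<sigma>" and \<tau>: "typed_subst \<Theta> \<Gamma> \<Gamma>' \<tau>"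
      using prems(3) by (auto simp: eq_subst_def)
    note ok = typed_subst_ok[OF \<Theta> prems(2)] and rule = rule_valid[OF tt_rule(1)]
    have typed: "\<forall>i<length \<Xi>. deriv \<Sigma> T \<Theta> \<Gamma>' (inst_premise (map_inst (act [] \<rho>) K) \<Xi> i)"
      if "typed_subst \<Theta> \<Gamma> \<Gamma>' \<rho>" for \<rho>
      using tt_rule(3) deriv_subst[OF \<Theta> prems(1,2) that] act_inst_premise[OF rule(1) tt_rule(2) ok[OF that]]
      by metis
    have eq: "\<forall>i<length \<Xi>. object_boundary (snd (\<Xi> ! i)) \<longrightarrow>
        deriv \<Sigma> T \<Theta> \<Gamma>' (inst_eq_premise (map_inst (act [] \<sigma>) K) (map_inst (act [] \<tau>) K) \<Xi> i)"
    proof (intro allI impI)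
      fix i assume i: "i < length \<Xi>" "object_boundary (snd (\<Xi> ! i))"
      then have "deriv \<Sigma> T \<Theta> \<Gamma>' (eq_judgement (act [] \<sigma>) (act [] \<tau>) (inst_premise K \<Xi> i))"
        using tt_rule(3) prems object_inst_premise[OF tt_rule(2)] by blast
      then show "deriv \<Sigma> T \<Theta> \<Gamma>' (inst_eq_premise (map_inst (act [] \<sigma>) K) (map_inst (act [] \<tau>) K) \<Xi> i)"
        using eq_inst_premise[OF rule(1) tt_rule(2) ok[OF \<sigma>] i] by simp
    qed
    note inst = is_inst_map_inst[OF tt_rule(2) ok[OF \<sigma>]] is_inst_map_inst[OF tt_rule(2) ok[OF \<tau>]]
    note act_j = act_inst_jthesis[OF rule(2) tt_rule(2) ok[OF \<sigma>]]
      act_inst_jthesis[OF rule(2) tt_rule(2) ok[OF \<tau>]]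
    show "deriv \<Sigma> T \<Theta> \<Gamma>' (eq_judgement (act [] \<sigma>) (act [] \<tau>) (JThesis (inst_jthesis K j)))"
    proof (cases j)
      case (IsType A)
      then show ?thesis
        using deriv_deriv_bdry.tt_congr_ty[OF _ inst typed[OF \<sigma>] typed[OF \<tau>] eq] tt_rule(1) act_j
        by simp
    next
      case (IsTerm t A)
      \<comment> \<open>The boundary premise is here \<open>BdTerm\<close> of the instantiated type,
        and its induction hypothesis is the type equation required by
        \<open>tt_congr_tm\<close>.\<close>
      have "deriv \<Sigma> T \<Theta> \<Gamma>' (JThesis (EqType (act [] \<sigma> (inst K A)) (act [] \<tau> (inst K A))))"
        using tt_rule(5) prems IsTerm by simp
      then show ?thesis
        using deriv_deriv_bdry.tt_congr_tm[OF _ inst typed[OF \<sigma>] typed[OF \<tau>] eq] tt_rule(1) act_j IsTerm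
        by simp
    qed (use obj in auto)
  qed
qed simp_all

end


section \<open>Instantiated telescopes\<close>

text \<open>The entry at position \<open>i\<close> lies under \<open>i\<close> binders of the
  telescope, so the index grows with the position and the new list is not a plain \<open>map\<close>
  of one substitution.\<close>

lemma bsubst_judgement_foldr_JAbs:
  "\<exists>As'. length As' = length As \<and> (\<forall>i < length As. As' ! i = bsubst (i + k) (FVar a) (As ! i)) \<and>
    bsubst_judgement k (FVar a) (foldr JAbs As (JThesis j)) =
      foldr JAbs As' (JThesis (map_jthesis (bsubst (length As + k) (FVar a)) j))"
proof (induction As arbitrary: k)
  case (Cons A As)
  obtain As' where "length As' = length As" "\<forall>i < length As. As' ! i = bsubst (i + Suc k) (FVar a) (As ! i)"
    "bsubst_judgement (Suc k) (FVar a) (foldr JAbs As (JThesis j)) =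
      foldr JAbs As' (JThesis (map_jthesis (bsubst (length As + Suc k) (FVar a)) j))"
    using Cons.IH by blast
  then show ?case
    by (intro exI[of _ "bsubst k (FVar a) A # As'"]) (auto simp: nth_Cons split: nat.split)
qed simp

lemma valid_judgement_foldr_JAbs:
  "valid_judgement \<Sigma> \<Phi> V d (foldr JAbs As J) \<longleftrightarrow>
    (\<forall>j < length As. valid_ty \<Sigma> \<Phi> V (j + d) (As ! j)) \<and> valid_judgement \<Sigma> \<Phi> V (length As + d) J"
  by (induction As arbitrary: d) (auto simp: All_less_Suc2)

lemma fill_foldr_BAbs:
  "fill (foldr BAbs As (BThesis b)) ((Abs ^^ length As) e) = foldr JAbs As (JThesis (fill_thesis b e))"
  by (induction As) auto

lemma has_abs_eq_funpow: "has_abs n e \<Longrightarrow> \<exists>e'. e = (Abs ^^ n) e'"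
proof (induction n arbitrary: e)
  case (Suc n)
  then show ?case by (metis comp_apply funpow.simps(2) has_abs.simps(2))
qed simp

section \<open>Opening derivable telescopes and instantiating metavariables\<close>

context raw_tt
begin

text \<open>Only the abstraction rule concludes an abstracted judgement. For metavariable congruence
  this becomes visible after evaluating \<open>fill_eq\<close> at the two object boundaries. The
  name \<open>a\<close> is whatever the derivation used.\<close>

lemma deriv_JAbsE:
  assumes "deriv \<Sigma> T \<Theta> \<Gamma> (JAbs A J)"
  obtains a where "deriv \<Sigma> T \<Theta> \<Gamma> (JThesis (IsType A))" "a \<notin> dom_ctx \<Gamma>" "a \<notin> fv_judgement J"
    "deriv \<Sigma> T \<Theta> (\<Gamma> @ [(a, A)]) (bsubst_judgement 0 (FVar a) J)"
  using assms
proof (cases rule: deriv.cases)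
  case (tt_meta_congr M As b ss ts)
  then show ?thesis by (cases b) auto
qed (use that in auto)

text \<open>Opening all abstractions of a derivable judgement and sending the fresh variables to \<open>ss\<close> and
  \<open>ts\<close> reduces simultaneous substitution for bound variables to substitution for free ones.\<close>

lemma open_telescope:
  assumes \<Theta>: "is_mctx \<Sigma> \<Theta>" and \<Gamma>': "good_ctx \<Sigma> \<Theta> \<Gamma>'"
  shows "deriv \<Sigma> T \<Theta> \<Gamma> (foldr JAbs As (JThesis j)) \<Longrightarrow> good_ctx \<Sigma> \<Theta> \<Gamma> \<Longrightarrow> eq_subst \<Theta> \<Gamma> \<Gamma>' \<sigma> \<tau>
    \<Longrightarrow> length ss = length As \<Longrightarrow> length ts = length As
    \<Longrightarrow> (\<And>i. i < length As \<Longrightarrow>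
          deriv \<Sigma> T \<Theta> \<Gamma>' (JThesis (IsTerm (ss ! i) (bsubsts (take i ss) (act [] \<sigma> (As ! i))))) \<and>
          deriv \<Sigma> T \<Theta> \<Gamma>' (JThesis (IsTerm (ts ! i) (bsubsts (take i ts) (act [] \<tau> (As ! i))))) \<and>
          deriv \<Sigma> T \<Theta> \<Gamma>' (JThesis (EqTerm (ss ! i) (ts ! i) (bsubsts (take i ss) (act [] \<sigma> (As ! i))))))
    \<Longrightarrow> \<exists>\<Gamma>1 \<sigma>1 \<tau>1 j1. good_ctx \<Sigma> \<Theta> \<Gamma>1 \<and> deriv \<Sigma> T \<Theta> \<Gamma>1 (JThesis j1) \<and> eq_subst \<Theta> \<Gamma>1 \<Gamma>' \<sigma>1 \<tau>1 \<and>
          map_jthesis (act [] \<sigma>1) j1 = map_jthesis (\<lambda>e. bsubsts ss (act [] \<sigma> e)) j \<and>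
          map_jthesis (act [] \<tau>1) j1 = map_jthesis (\<lambda>e. bsubsts ts (act [] \<tau> e)) j"
proof (induction "length As" arbitrary: As j \<Gamma> \<sigma> \<tau> ss ts)
  case 0
  then show ?case by auto
next
  case (Suc n)
  obtain A Bs where As: "As = A # Bs" "length Bs = n" using Suc.hyps(2) by (cases As) auto
  obtain s us where ss: "ss = s # us" "length us = n" using Suc.prems(4) As by (cases ss) auto
  obtain t vs where ts: "ts = t # vs" "length vs = n" using Suc.prems(5) As by (cases ts) auto
  obtain a where a: "deriv \<Sigma> T \<Theta> \<Gamma> (JThesis (IsType A))" "a \<notin> dom_ctx \<Gamma>"
    "deriv \<Sigma> T \<Theta> (\<Gamma> @ [(a, A)]) (bsubst_judgement 0 (FVar a) (foldr JAbs Bs (JThesis j)))"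
    using Suc.prems(1) As by (auto elim: deriv_JAbsE)
  have A: "valid_ty \<Sigma> (mv_arity \<Theta>) (dom_ctx \<Gamma>) 0 A"
    using deriv_type_valid[OF \<Theta> Suc.prems(2) a(1)] .
  have Bs: "\<And>i. i < n \<Longrightarrow> valid_ty \<Sigma> (mv_arity \<Theta>) (dom_ctx \<Gamma>) (Suc i) (Bs ! i)"
    and j: "valid_jthesis \<Sigma> (mv_arity \<Theta>) (dom_ctx \<Gamma>) (Suc n) j"
    using deriv_valid(1)[OF \<Theta> Suc.prems(1)] Suc.prems(2) As by (auto simp: valid_judgement_foldr_JAbs)
  \<comment> \<open>Opening with \<open>a\<close> replaces the tail \<open>Bs\<close> by a list that
    shares only its length, which is why the induction runs on \<open>length As\<close>.\<close>
  obtain Bs' where Bs': "length Bs' = n" "\<And>i. i < n \<Longrightarrow> Bs' ! i = bsubst i (FVar a) (Bs ! i)"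
    "bsubst_judgement 0 (FVar a) (foldr JAbs Bs (JThesis j)) =
      foldr JAbs Bs' (JThesis (map_jthesis (bsubst n (FVar a)) j))"
    using bsubst_judgement_foldr_JAbs[of Bs 0 a j] As(2) by auto
  have st: "deriv \<Sigma> T \<Theta> \<Gamma>' (JThesis (IsTerm s (act [] \<sigma> A)))"
    "deriv \<Sigma> T \<Theta> \<Gamma>' (JThesis (IsTerm t (act [] \<tau> A)))"
    "deriv \<Sigma> T \<Theta> \<Gamma>' (JThesis (EqTerm s t (act [] \<sigma> A)))"
    using Suc.prems(6)[of 0] As ss ts by auto
  note s = deriv_term_valid[OF \<Theta> \<Gamma>' st(1)] and t = deriv_term_valid[OF \<Theta> \<Gamma>' st(2)]
  let ?\<sigma> = "\<sigma>(a := s)" and ?\<tau> = "\<tau>(a := t)"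
  have ok: "act_ok \<Sigma> (mv_arity \<Theta>) (dom_ctx \<Gamma>) (mv_arity \<Theta>) (dom_ctx \<Gamma>') [] \<sigma>"
    "act_ok \<Sigma> (mv_arity \<Theta>) (dom_ctx \<Gamma>) (mv_arity \<Theta>) (dom_ctx \<Gamma>') [] \<tau>"
    using Suc.prems(3) by (auto simp: eq_subst_def intro: typed_subst_ok[OF \<Theta> \<Gamma>'])
  note open_\<sigma> = act_bsubst_FVar[OF _ a(2) ok(1) s] and open_\<tau> = act_bsubst_FVar[OF _ a(2) ok(2) t]
  have "eq_subst \<Theta> (\<Gamma> @ [(a, A)]) \<Gamma>' ?\<sigma> ?\<tau>"
    using Suc.prems(2,3) a(2) A st by (rule eq_subst_upd)
  moreover have "good_ctx \<Sigma> \<Theta> (\<Gamma> @ [(a, A)])"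
    using Suc.prems(2) A by (rule good_ctx_snoc)
  moreover have "deriv \<Sigma> T \<Theta> \<Gamma>' (JThesis (IsTerm (us ! i) (bsubsts (take i us) (act [] ?\<sigma> (Bs' ! i))))) \<and>
      deriv \<Sigma> T \<Theta> \<Gamma>' (JThesis (IsTerm (vs ! i) (bsubsts (take i vs) (act [] ?\<tau> (Bs' ! i))))) \<and>
      deriv \<Sigma> T \<Theta> \<Gamma>' (JThesis (EqTerm (us ! i) (vs ! i) (bsubsts (take i us) (act [] ?\<sigma> (Bs' ! i)))))"
    if i: "i < length Bs'" for i
  proof -
    \<comment> \<open>The head \<open>s\<close> now sits in the updated substitution. Moving it back
      to the front of the arguments shifts each position by one.\<close>
    have "bsubsts (take i us) (act [] ?\<sigma> (Bs' ! i)) = bsubsts (take (Suc i) ss) (act [] \<sigma> (As ! Suc i))"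
      using i Bs' open_\<sigma>[OF Bs] bsubsts_Cons[OF s, of "take i us"] ss As
      by (simp del: fun_upd_apply)
    moreover have "bsubsts (take i vs) (act [] ?\<tau> (Bs' ! i)) = bsubsts (take (Suc i) ts) (act [] \<tau> (As ! Suc i))"
      using i Bs' open_\<tau>[OF Bs] bsubsts_Cons[OF t, of "take i vs"] ts As
      by (simp del: fun_upd_apply)
    ultimately show ?thesis using Suc.prems(6)[of "Suc i"] i Bs'(1) As ss ts by simp
  qed
  ultimately obtain \<Gamma>1 \<sigma>1 \<tau>1 j1 where 1: "good_ctx \<Sigma> \<Theta> \<Gamma>1" "deriv \<Sigma> T \<Theta> \<Gamma>1 (JThesis j1)"
    "eq_subst \<Theta> \<Gamma>1 \<Gamma>' \<sigma>1 \<tau>1"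
    "map_jthesis (act [] \<sigma>1) j1 = map_jthesis (\<lambda>e. bsubsts us (act [] ?\<sigma> e)) (map_jthesis (bsubst n (FVar a)) j)"
    "map_jthesis (act [] \<tau>1) j1 = map_jthesis (\<lambda>e. bsubsts vs (act [] ?\<tau> e)) (map_jthesis (bsubst n (FVar a)) j)"
    using Suc.hyps(1)[OF Bs'(1)[symmetric] a(3)[unfolded Bs'(3)], of ?\<sigma> ?\<tau> us vs] Bs'(1) ss(2) ts(2)
    by (auto simp del: fun_upd_apply)
  have "map_jthesis (act [] \<sigma>1) j1 = map_jthesis (\<lambda>e. bsubsts ss (act [] \<sigma> e)) j"
    unfolding 1(4) jthesis.map_comp using j
    by (rule map_jthesis_cong) (simp add: open_\<sigma> bsubsts_Cons[OF s] ss del: fun_upd_apply)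
  moreover have "map_jthesis (act [] \<tau>1) j1 = map_jthesis (\<lambda>e. bsubsts ts (act [] \<tau> e)) j"
    unfolding 1(5) jthesis.map_comp using j
    by (rule map_jthesis_cong) (simp add: open_\<tau> bsubsts_Cons[OF t] ts del: fun_upd_apply)
  ultimately show ?case using 1(1-3) by blast
qed

text \<open>The premise of a derivable instantiation uses the prefix before \<open>M\<close>. As the
  boundary of \<open>M\<close> mentions only earlier metavariables, the prefix may be replaced by
  all of \<open>I\<close>, giving an abstracted judgement in which \<open>I\<close> itself
  appears.\<close>

lemma derivable_inst_lookup:
  assumes "is_mctx \<Sigma> \<Xi>" "derivable_inst \<Sigma> T \<Theta> \<Gamma> \<Xi> I" "map_of \<Xi> M = Some (foldr BAbs As (BThesis b))"
  obtains e where "map_of I M = Some ((Abs ^^ length As) e)"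
    "deriv \<Sigma> T \<Theta> \<Gamma> (foldr JAbs (map (inst I) As) (JThesis (fill_thesis (inst_bthesis I b) e)))"
proof -
  let ?B = "foldr BAbs As (BThesis b)"
  have inst: "is_inst \<Sigma> \<Theta> \<Gamma> \<Xi> I" using assms(2) by (simp add: derivable_inst_def)
  then obtain i where i: "i < length \<Xi>" "\<Xi> ! i = (M, ?B)" "map_of I M = Some (snd (I ! i))"
    using map_of_parallel[OF _ assms(3), of I] by (auto simp: is_inst_def)
  have "abs_depth ?B = length As" by (induction As) auto
  then obtain e where e: "snd (I ! i) = (Abs ^^ length As) e"
    using has_abs_eq_funpow is_inst_has_abs[OF inst i(1)] i(2) by fastforce
  have B: "valid_boundary \<Sigma> (mv_arity (take i \<Xi>)) {} 0 ?B"
    using mctx_nth_valid[OF assms(1) i(1)] i(2) by simp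
  \<comment> \<open>A metavariable in the scope of the boundary is already bound by the prefix, and
    bindings in a prefix take precedence in lookup.\<close>
  have I: "map_of (take i I) N = map_of I N" if "N \<in> dom (mv_arity (take i \<Xi>))" for N
  proof -
    have "map_of (take i I) N \<noteq> None"
      using is_inst_dom[OF is_inst_take[OF inst]] that by blast
    then obtain e where "map_of (take i I) N = Some e" by blast
    then have "map_of (take i I @ drop i I) N = Some e"
      unfolding map_of_append by (rule map_add_find_right)
    then show ?thesis using \<open>map_of (take i I) N = Some e\<close> by simp
  qed
  have "inst_boundary (take i I) ?B = inst_boundary I ?B"
    unfolding inst_boundary_eq inst_eq_act
    using B by (rule on_boundary_cong) (rule act_cong, assumption, simp, erule I)
  then have "inst_premise I \<Xi> i =
      foldr JAbs (map (inst I) As) (JThesis (fill_thesis (inst_bthesis I b) e))"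
    using i(2) e fill_foldr_BAbs[of "map (inst I) As" "inst_bthesis I b" e]
    by (simp add: inst_premise_def inst_boundary_eq on_boundary_foldr_BAbs)
  then show thesis
    using that i(1,3) e assms(2) by (metis derivable_inst_def)
qed

lemma derivable_inst_snoc:
  assumes "is_mctx \<Sigma> \<Theta>" "good_ctx \<Sigma> \<Theta> \<Gamma>" "derivable_inst \<Sigma> T \<Theta> \<Gamma> \<Xi> I" "a \<notin> dom_ctx \<Gamma>"
    "valid_ty \<Sigma> (mv_arity \<Theta>) (dom_ctx \<Gamma>) 0 A"
  shows "derivable_inst \<Sigma> T \<Theta> (\<Gamma> @ [(a, A)]) \<Xi> I"
proof -
  have "is_inst \<Sigma> \<Theta> (\<Gamma> @ [(a, A)]) \<Xi> I"
    using assms(3) by (auto simp: derivable_inst_def is_inst_def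
        intro: valid_mono[OF _ subset_insertI le_refl map_le_refl])
  then show ?thesis
    using assms(3) weakening[OF assms(1,2,4,5)] by (simp add: derivable_inst_def)
qed

text \<open>The entry of \<open>M\<close> is the head of a derivable abstracted judgement. Opening
  its telescope turns evaluation at \<open>ts\<close> into a typed substitution for free variables,
  under which derivability is known to be preserved.\<close>

lemma deriv_meta_head:
  assumes "is_mctx \<Sigma> \<Theta>" "is_mctx \<Sigma> \<Xi>" "good_ctx \<Sigma> \<Theta> \<Gamma>" "derivable_inst \<Sigma> T \<Theta> \<Gamma> \<Xi> I"
    "map_of \<Xi> M = Some (foldr BAbs As (BThesis b))" "length ts = length As"
    "\<forall>j < length As. deriv \<Sigma> T \<Theta> \<Gamma> (JThesis (IsTerm (ts ! j) (bsubsts (take j ts) (inst I (As ! j)))))"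
  shows "deriv \<Sigma> T \<Theta> \<Gamma>
    (JThesis (fill_thesis (map_bthesis (bsubsts ts) (inst_bthesis I b)) (meta_head I M ts)))"
proof -
  obtain e where e: "map_of I M = Some ((Abs ^^ length As) e)"
    "deriv \<Sigma> T \<Theta> \<Gamma> (foldr JAbs (map (inst I) As) (JThesis (fill_thesis (inst_bthesis I b) e)))"
    using derivable_inst_lookup[OF assms(2,4,5)] .
  obtain \<Gamma>1 \<sigma> \<tau> j where 1: "good_ctx \<Sigma> \<Theta> \<Gamma>1" "deriv \<Sigma> T \<Theta> \<Gamma>1 (JThesis j)" "eq_subst \<Theta> \<Gamma>1 \<Gamma> \<sigma> \<tau>"
    "map_jthesis (act [] \<sigma>) j = map_jthesis (\<lambda>e. bsubsts ts (act [] FVar e)) (fill_thesis (inst_bthesis I b) e)"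
    \<comment> \<open>Both lists of arguments are taken to be \<open>ts\<close>; the equations
      between them hold by reflexivity.\<close>
    using open_telescope[OF assms(1,3) e(2) assms(3) eq_subst_FVar, of ts ts] assms(6,7)
      deriv_deriv_bdry.tt_eqtm_refl by (auto simp del: act_Nil_FVar) (simp, blast)
  have "deriv \<Sigma> T \<Theta> \<Gamma> (JThesis (map_jthesis (act [] \<sigma>) j))"
    using deriv_subst[OF assms(1) 1(1) assms(3) _ 1(2)] 1(3) by (simp add: eq_subst_def)
  moreover have "meta_head I M ts = bsubsts ts e"
    using e(1) assms(6) by (simp add: meta_head_def bsubsts_def)
  ultimately show ?thesis unfolding 1(4) by (simp add: map_fill_thesis)
qed

text \<open>Both evaluations of the entry of \<open>M\<close> come from one opened judgement under
  two equal substitutions, so \<open>deriv_eq_subst\<close> yields the equation between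
  them.\<close>

lemma deriv_eq_meta_head:
  assumes "is_mctx \<Sigma> \<Theta>" "is_mctx \<Sigma> \<Xi>" "good_ctx \<Sigma> \<Theta> \<Gamma>" "derivable_inst \<Sigma> T \<Theta> \<Gamma> \<Xi> I"
    "map_of \<Xi> M = Some (foldr BAbs As (BThesis b))" "class_bthesis b \<in> {Ty, Tm}"
    "length ss = length As" "length ts = length As"
    "\<forall>j < length As. deriv \<Sigma> T \<Theta> \<Gamma> (JThesis (IsTerm (ss ! j) (bsubsts (take j ss) (inst I (As ! j)))))"
    "\<forall>j < length As. deriv \<Sigma> T \<Theta> \<Gamma> (JThesis (IsTerm (ts ! j) (bsubsts (take j ts) (inst I (As ! j)))))"
    "\<forall>j < length As. deriv \<Sigma> T \<Theta> \<Gamma>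
      (JThesis (EqTerm (ss ! j) (ts ! j) (bsubsts (take j ss) (inst I (As ! j)))))"
  shows "deriv \<Sigma> T \<Theta> \<Gamma>
    (fill_eq (BThesis (map_bthesis (bsubsts ss) (inst_bthesis I b))) (meta_head I M ss) (meta_head I M ts))"
proof -
  obtain e where e: "map_of I M = Some ((Abs ^^ length As) e)"
    "deriv \<Sigma> T \<Theta> \<Gamma> (foldr JAbs (map (inst I) As) (JThesis (fill_thesis (inst_bthesis I b) e)))"
    using derivable_inst_lookup[OF assms(2,4,5)] .
  obtain \<Gamma>1 \<sigma> \<tau> j where 1: "good_ctx \<Sigma> \<Theta> \<Gamma>1" "deriv \<Sigma> T \<Theta> \<Gamma>1 (JThesis j)" "eq_subst \<Theta> \<Gamma>1 \<Gamma> \<sigma> \<tau>"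
    "map_jthesis (act [] \<sigma>) j = map_jthesis (\<lambda>e. bsubsts ss (act [] FVar e)) (fill_thesis (inst_bthesis I b) e)"
    "map_jthesis (act [] \<tau>) j = map_jthesis (\<lambda>e. bsubsts ts (act [] FVar e)) (fill_thesis (inst_bthesis I b) e)"
    using open_telescope[OF assms(1,3) e(2) assms(3) eq_subst_FVar, of ss ts] assms(7-11)
    by (auto simp del: act_Nil_FVar) (simp, blast)
  \<comment> \<open>The image of \<open>j\<close> is the instantiated object boundary filled with a
    head, and an action does not change the form of a thesis.\<close>
  have "object_judgement (JThesis j)"
    using 1(4) assms(6) by (cases b; cases j) auto
  then have "deriv \<Sigma> T \<Theta> \<Gamma> (eq_judgement (act [] \<sigma>) (act [] \<tau>) (JThesis j))"
    using deriv_eq_subst(1)[OF assms(1) 1(2)] 1(1,3) assms(3) by blast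
  moreover have "eq_judgement (act [] \<sigma>) (act [] \<tau>) (JThesis j) =
      fill_eq (BThesis (map_bthesis (bsubsts ss) (inst_bthesis I b))) (meta_head I M ss) (meta_head I M ts)"
    using 1(4,5) assms(6-8) e(1) by (cases b; cases j) (auto simp: meta_head_def bsubsts_def)
  ultimately show ?thesis by simp
qed

text \<open>Variables are moved only by the renamings forced at binders, so \<open>R\<close> admits
  just variables of the context. Derivability of \<open>I\<close> belongs to the invariant because
  metavariables are also instantiated inside abstractions, where the context has grown; it persists
  by weakening.\<close>

theorem deriv_inst:
  assumes "is_mctx \<Sigma> \<Theta>" "is_mctx \<Sigma> \<Xi>" "good_ctx \<Sigma> \<Theta> \<Gamma>" "good_ctx \<Sigma> \<Xi> \<Gamma>"
    "derivable_inst \<Sigma> T \<Theta> \<Gamma> \<Xi> I" "inst_vctx I \<Gamma> = \<Gamma>"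
  shows "deriv \<Sigma> T \<Xi> \<Gamma> J \<Longrightarrow> deriv \<Sigma> T \<Theta> \<Gamma> (inst_judgement I J)"
    and "deriv_bdry \<Sigma> T \<Xi> \<Gamma> B \<Longrightarrow> deriv_bdry \<Sigma> T \<Theta> \<Gamma> (inst_boundary I B)"
proof -
  interpret derivation_action \<Sigma> T \<Theta> \<Xi> I "\<lambda>\<Gamma>. good_ctx \<Sigma> \<Theta> \<Gamma> \<and> derivable_inst \<Sigma> T \<Theta> \<Gamma> \<Xi> I"
    "\<lambda>\<Gamma> t A. \<exists>a. t = FVar a \<and> map_of \<Gamma> a = Some A"
  proof
    show "\<exists>b. FVar a = FVar b \<and> map_of (\<Gamma> @ [(a, A)]) b = Some A"
      if "a \<notin> dom_ctx \<Gamma>" for \<Gamma> a A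
      using map_of_snoc_fresh[OF that] by blast
    show "act_ok \<Sigma> (mv_arity \<Xi>) {} (mv_arity \<Theta>) (dom_ctx \<Gamma>) I FVar"
      if "good_ctx \<Sigma> \<Theta> \<Gamma> \<and> derivable_inst \<Sigma> T \<Theta> \<Gamma> \<Xi> I" for \<Gamma>
      using that by (auto simp: derivable_inst_def intro: is_inst_act_ok)
  qed (use assms(1,2) in \<open>auto simp: good_ctx_snoc derivable_inst_snoc map_of_snoc
      intro: deriv_deriv_bdry.tt_var deriv_meta_head deriv_eq_meta_head\<close>)
  \<comment> \<open>The variable rule assigns the type stored in \<open>\<Gamma>\<close>, while the
    instantiated judgement has \<open>inst I A\<close>. These agree because
    \<open>inst_vctx I \<Gamma> = \<Gamma>\<close>.\<close>
  have typed: "typed \<Gamma> \<Gamma> FVar"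
    unfolding typed_def
  proof (intro allI impI)
    fix a A assume "map_of \<Gamma> a = Some A"
    then have "map_of (inst_vctx I \<Gamma>) a = Some (inst I A)"
      by (simp add: inst_vctx_def map_of_map)
    then show "\<exists>b. FVar a = FVar b \<and> map_of \<Gamma> b = Some (act I FVar A)"
      using assms(6) by (simp add: inst_eq_act)
  qed
  show "deriv \<Sigma> T \<Theta> \<Gamma> (inst_judgement I J)" if "deriv \<Sigma> T \<Xi> \<Gamma> J"
    using deriv_act(1)[OF that] assms(3-5) typed by (simp add: inst_judgement_eq inst_eq_act)
  show "deriv_bdry \<Sigma> T \<Theta> \<Gamma> (inst_boundary I B)" if "deriv_bdry \<Sigma> T \<Xi> \<Gamma> B"
    using deriv_act(2)[OF that] assms(3-5) typed by (simp add: inst_boundary_eq inst_eq_act)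
qed

end

theorem mainTheorem3:
  fixes \<Sigma> :: "'s signature" and T :: "'s raw_rule set"
    and \<Xi> \<Theta> :: "'s mctx" and \<Gamma> :: "'s vctx" and I :: "'s inst_map"
  assumes "raw_type_theory \<Sigma> T"
    and "is_ctx \<Sigma> \<Theta> \<Gamma>"
    and "is_ctx \<Sigma> \<Xi> \<Gamma>"
    and "derivable_inst \<Sigma> T \<Theta> \<Gamma> \<Xi> I"
    and "inst_vctx I \<Gamma> = \<Gamma>"
  shows "(\<forall>J. deriv \<Sigma> T \<Xi> \<Gamma> J \<longrightarrow> deriv \<Sigma> T \<Theta> \<Gamma> (inst_judgement I J)) \<and>
         (\<forall>B. deriv_bdry \<Sigma> T \<Xi> \<Gamma> B \<longrightarrow> deriv_bdry \<Sigma> T \<Theta> \<Gamma> (inst_boundary I B))"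
proof -
  interpret raw_tt \<Sigma> T by unfold_locales (rule assms(1))
  show ?thesis
    using deriv_inst[OF _ _ is_vctx_good_ctx is_vctx_good_ctx assms(4,5)] assms(2,3)
    by (simp add: is_ctx_def)
qed

end
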